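(* Let $V$ be a nontrivial finite-dimensional irreducible $\boxtimes$-module over $\mathbb F$. Then for $a\in\mathbb F\setminus\{0,1\}$ the following (i), (ii) are equivalent. (i) $V$ is isomorphic to an evaluation module with evaluation parameter $a$ (that is, $V\cong V_d(a)$ for some integer $d\ge 1$). (ii) Each of the following four elements of $\boxtimes$ vanishes on $V$: $$a x_{01}+(1-a)x_{02}-x_{03},\qquad a x_{10}+(1-a)x_{13}-x_{12},$$ $$a x_{23}+(1-a)x_{20}-x_{21},\qquad a x_{32}+(1-a)x_{31}-x_{30}.$$
   Context: $\mathbb F$ is an algebraically closed field of characteristic $0$, and $\mathbb I=\{0,1,2,3\}$. The tetrahedron algebra $\boxtimes$ is the Lie algebra over $\mathbb F$ with generators $\{x_{ij}\mid i,j\in\mathbb I,\ i\ne j\}$ and relations: (i) $x_{ij}+x_{ji}=0$ for distinct $i,j$; (ii) $[x_{ij},x_{jk}]=2x_{ij}+2x_{jk}$ for mutually distinct $i,j,k$; (iii) $[x_{ij},[x_{ij},[x_{ij},x_{k\ell}]]]=4[x_{ij},x_{k\ell}]$ for mutually distinct $i,j,k,\ell$. The trivial $\boxtimes$-module is the one-dimensional module on which every element of $\boxtimes$ acts as $0$ (unique up to isomorphism); other irreducible modules are nontrivial. Let $\mathfrak{sl}_2=\mathfrak{sl}_2(\mathbb F)$ with basis $e,f,h$, $[h,e]=2e$, $[h,f]=-2f$, $[e,f]=h$. Put $x=2e-h$, $y=-2f-h$, $z=h$. For $a\in\mathbb F\setminus\{0,1\}$ let $EV_a:\boxtimes\to\mathfrak{sl}_2$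 be the (surjective) Lie algebra homomorphism with $x_{12}\mapsto x$, $x_{23}\mapsto y$, $x_{31}\mapsto z$, $x_{03}\mapsto ay+(a-1)z$, $x_{01}\mapsto(1-a^{-1})z-a^{-1}x$, $x_{02}\mapsto(1-a)^{-1}x+a(1-a)^{-1}y$. For $d\ge0$ let $V_d$ be the irreducible $\mathfrak{sl}_2$-module of dimension $d+1$. For $d\ge 1$ and $a\in\mathbb F\setminus\{0,1\}$, the evaluation module $V_d(a)$ is the $\boxtimes$-module obtained from $V_d$ by pulling back the action via $EV_a$; $a$ is called its evaluation parameter. *)

theory Defs
  imports "HOL-Computational_Algebra.Computational_Algebra"
begin

section \<open>Lie algebras and their modules\<close>

locale lie_algebra = vector_space scale
  for scale :: "'k::field \<Rightarrow> 'l::ab_group_add \<Rightarrow> 'l" +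
  fixes bracket :: "'l \<Rightarrow> 'l \<Rightarrow> 'l"
  assumes bracket_add_left: "bracket (x + y) z = bracket x z + bracket y z"
    and bracket_add_right: "bracket x (y + z) = bracket x y + bracket x z"
    and bracket_scale_left: "bracket (scale c x) y = scale c (bracket x y)"
    and bracket_scale_right: "bracket x (scale c y) = scale c (bracket x y)"
    and bracket_self: "bracket x x = 0"
    and jacobi: "bracket x (bracket y z) + bracket y (bracket z x) + bracket z (bracket x y) = 0"

definition lie_hom ::
  "('k::field \<Rightarrow> 'l::ab_group_add \<Rightarrow> 'l) \<Rightarrow> ('l \<Rightarrow> 'l \<Rightarrow> 'l) \<Rightarrow>
   ('k \<Rightarrow> 'm::ab_group_add \<Rightarrow> 'm) \<Rightarrow> ('m \<Rightarrow> 'm \<Rightarrow> 'm) \<Rightarrow> ('l \<Rightarrow> 'm) \<Rightarrow> bool"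
  where "lie_hom s b s' b' \<phi> \<longleftrightarrow>
    Vector_Spaces.linear s s' \<phi> \<and> (\<forall>x y. \<phi> (b x y) = b' (\<phi> x) (\<phi> y))"

text \<open>
  The underlying space of a module is a subspace \<open>V\<close> of a type, so that a family of
  modules of varying dimension can live in one type. The action is only constrained on \<open>V\<close>.
\<close>

locale lie_module = L: lie_algebra lscale bracket + vector_space scale
  for lscale :: "'k::field \<Rightarrow> 'l::ab_group_add \<Rightarrow> 'l" and bracket :: "'l \<Rightarrow> 'l \<Rightarrow> 'l"
    and scale :: "'k \<Rightarrow> 'v::ab_group_add \<Rightarrow> 'v" +
  fixes V :: "'v set" and act :: "'l \<Rightarrow> 'v \<Rightarrow> 'v"
  assumes subspace_V: "module.subspace scale V"
    and act_closed: "v \<in> V \<Longrightarrow> act x v \<in> V"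
    and act_add_left: "v \<in> V \<Longrightarrow> act (x + y) v = act x v + act y v"
    and act_scale_left: "v \<in> V \<Longrightarrow> act (lscale c x) v = scale c (act x v)"
    and act_add_right: "v \<in> V \<Longrightarrow> w \<in> V \<Longrightarrow> act x (v + w) = act x v + act x w"
    and act_scale_right: "v \<in> V \<Longrightarrow> act x (scale c v) = scale c (act x v)"
    and act_bracket: "v \<in> V \<Longrightarrow> act (bracket x y) v = act x (act y v) - act y (act x v)"

definition fin_dim :: "('k::field \<Rightarrow> 'v::ab_group_add \<Rightarrow> 'v) \<Rightarrow> 'v set \<Rightarrow> bool"
  where "fin_dim scale V \<longleftrightarrow> (\<exists>B. finite B \<and> V = module.span scale B)"

definition submodule ::
  "('k::field \<Rightarrow> 'v::ab_group_add \<Rightarrow> 'v) \<Rightarrow> 'v set \<Rightarrow> ('l \<Rightarrow> 'v \<Rightarrow> 'v) \<Rightarrow> 'v set \<Rightarrow> bool"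
  where "submodule scale V act U \<longleftrightarrow>
    module.subspace scale U \<and> U \<subseteq> V \<and> (\<forall>x. \<forall>u\<in>U. act x u \<in> U)"

definition irreducible_module ::
  "('k::field \<Rightarrow> 'v::ab_group_add \<Rightarrow> 'v) \<Rightarrow> 'v set \<Rightarrow> ('l \<Rightarrow> 'v \<Rightarrow> 'v) \<Rightarrow> bool"
  where "irreducible_module scale V act \<longleftrightarrow>
    V \<noteq> {0} \<and> (\<forall>U. submodule scale V act U \<longrightarrow> U = {0} \<or> U = V)"

definition vanishes_on :: "'v::zero set \<Rightarrow> ('l \<Rightarrow> 'v \<Rightarrow> 'v) \<Rightarrow> 'l \<Rightarrow> bool"
  where "vanishes_on V act x \<longleftrightarrow> (\<forall>v\<in>V. act x v = 0)"

definition trivial_module ::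
  "('k::field \<Rightarrow> 'v::ab_group_add \<Rightarrow> 'v) \<Rightarrow> 'v set \<Rightarrow> ('l \<Rightarrow> 'v \<Rightarrow> 'v) \<Rightarrow> bool"
  where "trivial_module scale V act \<longleftrightarrow>
    vector_space.dim scale V = 1 \<and> (\<forall>x. vanishes_on V act x)"

definition module_isomorphic ::
  "('k::field \<Rightarrow> 'v::ab_group_add \<Rightarrow> 'v) \<Rightarrow> 'v set \<Rightarrow> ('l \<Rightarrow> 'v \<Rightarrow> 'v) \<Rightarrow>
   ('k \<Rightarrow> 'w::ab_group_add \<Rightarrow> 'w) \<Rightarrow> 'w set \<Rightarrow> ('l \<Rightarrow> 'w \<Rightarrow> 'w) \<Rightarrow> bool"
  where "module_isomorphic s V act s' W act' \<longleftrightarrow>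
    (\<exists>\<phi>. bij_betw \<phi> V W \<and>
      (\<forall>v\<in>V. \<forall>w\<in>V. \<phi> (v + w) = \<phi> v + \<phi> w) \<and>
      (\<forall>c. \<forall>v\<in>V. \<phi> (s c v) = s' c (\<phi> v)) \<and>
      (\<forall>x. \<forall>v\<in>V. \<phi> (act x v) = act' x (\<phi> v)))"

section \<open>Lie algebras by generators and relations\<close>

datatype ('g, 'k) lie_term =
  Gen 'g
| Zero
| Add "('g, 'k) lie_term" "('g, 'k) lie_term"
| Scale 'k "('g, 'k) lie_term"
| Bracket "('g, 'k) lie_term" "('g, 'k) lie_term"

text \<open>
  \<open>lie_eq R\<close> is the least congruence on terms that contains \<open>R\<close> and all instances of the Lie
  algebra axioms; the terms modulo \<open>lie_eq R\<close> are the Lie algebra with generators \<open>'g\<close> and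
  defining relations \<open>s = t\<close> for \<open>(s, t) \<in> R\<close>. The negative of \<open>t\<close> is \<open>Scale (-1) t\<close>.
\<close>

inductive lie_eq ::
  "(('g, 'k::field) lie_term \<times> ('g, 'k) lie_term) set \<Rightarrow>
   ('g, 'k) lie_term \<Rightarrow> ('g, 'k) lie_term \<Rightarrow> bool"
  for R :: "(('g, 'k) lie_term \<times> ('g, 'k) lie_term) set"
  where
    rel: "(s, t) \<in> R \<Longrightarrow> lie_eq R s t"
  | refl: "lie_eq R t t"
  | sym: "lie_eq R s t \<Longrightarrow> lie_eq R t s"
  | trans: "lie_eq R s t \<Longrightarrow> lie_eq R t u \<Longrightarrow> lie_eq R s u"
  | cong_add: "lie_eq R s s' \<Longrightarrow> lie_eq R t t' \<Longrightarrow> lie_eq R (Add s t) (Add s' t')"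
  | cong_scale: "lie_eq R t t' \<Longrightarrow> lie_eq R (Scale c t) (Scale c t')"
  | cong_bracket: "lie_eq R s s' \<Longrightarrow> lie_eq R t t' \<Longrightarrow> lie_eq R (Bracket s t) (Bracket s' t')"
  | add_assoc: "lie_eq R (Add (Add s t) u) (Add s (Add t u))"
  | add_comm: "lie_eq R (Add s t) (Add t s)"
  | add_zero: "lie_eq R (Add Zero t) t"
  | add_neg: "lie_eq R (Add (Scale (-1) t) t) Zero"
  | scale_add: "lie_eq R (Scale c (Add s t)) (Add (Scale c s) (Scale c t))"
  | add_scale: "lie_eq R (Scale (c + d) t) (Add (Scale c t) (Scale d t))"
  | scale_scale: "lie_eq R (Scale c (Scale d t)) (Scale (c * d) t)"
  | scale_one: "lie_eq R (Scale 1 t) t"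
  | br_add_left: "lie_eq R (Bracket (Add s t) u) (Add (Bracket s u) (Bracket t u))"
  | br_add_right: "lie_eq R (Bracket s (Add t u)) (Add (Bracket s t) (Bracket s u))"
  | br_scale_left: "lie_eq R (Bracket (Scale c s) t) (Scale c (Bracket s t))"
  | br_scale_right: "lie_eq R (Bracket s (Scale c t)) (Scale c (Bracket s t))"
  | br_self: "lie_eq R (Bracket t t) Zero"
  | br_jacobi: "lie_eq R (Add (Add (Bracket s (Bracket t u)) (Bracket t (Bracket u s)))
                              (Bracket u (Bracket s t))) Zero"

primrec lie_term_eval ::
  "('k \<Rightarrow> 'l::zero \<Rightarrow> 'l) \<Rightarrow> ('l \<Rightarrow> 'l \<Rightarrow> 'l) \<Rightarrow> ('l \<Rightarrow> 'l \<Rightarrow> 'l) \<Rightarrow> ('g \<Rightarrow> 'l) \<Rightarrow>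
   ('g, 'k) lie_term \<Rightarrow> 'l"
  where
    "lie_term_eval sc pl br g (Gen a) = g a"
  | "lie_term_eval sc pl br g Zero = 0"
  | "lie_term_eval sc pl br g (Add s t) =
       pl (lie_term_eval sc pl br g s) (lie_term_eval sc pl br g t)"
  | "lie_term_eval sc pl br g (Scale c t) = sc c (lie_term_eval sc pl br g t)"
  | "lie_term_eval sc pl br g (Bracket s t) =
       br (lie_term_eval sc pl br g s) (lie_term_eval sc pl br g t)"

lemma (in lie_algebra) lie_eq_eval:
  assumes "lie_eq R s t"
    and "\<And>s t. (s, t) \<in> R \<Longrightarrow>
      lie_term_eval scale (+) bracket g s = lie_term_eval scale (+) bracket g t"
  shows "lie_term_eval scale (+) bracket g s = lie_term_eval scale (+) bracket g t"
  using assms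
  by (induction rule: lie_eq.induct)
    (simp_all add: bracket_add_left bracket_add_right bracket_scale_left bracket_scale_right
      bracket_self jacobi jacobi[unfolded add.assoc] algebra_simps)

section \<open>The tetrahedron algebra\<close>

definition tet_index :: "nat set" where "tet_index = {0, 1, 2, 3}"

typedef tet_gen = "{(i, j). i \<in> tet_index \<and> j \<in> tet_index \<and> i \<noteq> j}"
  by (rule exI[of _ "(0, 1)"]) (simp add: tet_index_def)

definition tet_X :: "nat \<Rightarrow> nat \<Rightarrow> (tet_gen, 'k) lie_term"
  where "tet_X i j = Gen (Abs_tet_gen (i, j))"

definition tet_rels :: "((tet_gen, 'k::field) lie_term \<times> (tet_gen, 'k) lie_term) set"
  where "tet_rels =
    {(Add (tet_X i j) (tet_X j i), Zero) | i j.
        {i, j} \<subseteq> tet_index \<and> distinct [i, j]} \<union>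
    {(Bracket (tet_X i j) (tet_X j k), Add (Scale 2 (tet_X i j)) (Scale 2 (tet_X j k))) | i j k.
        {i, j, k} \<subseteq> tet_index \<and> distinct [i, j, k]} \<union>
    {(Bracket (tet_X i j) (Bracket (tet_X i j) (Bracket (tet_X i j) (tet_X k l))),
      Scale 4 (Bracket (tet_X i j) (tet_X k l))) | i j k l.
        {i, j, k, l} \<subseteq> tet_index \<and> distinct [i, j, k, l]}"

quotient_type (overloaded) 'k tet = "(tet_gen, 'k::field) lie_term" / "lie_eq tet_rels"
  by (rule equivpI) (auto intro: reflpI sympI transpI lie_eq.refl lie_eq.sym lie_eq.trans)

instantiation tet :: (field) ab_group_add
begin

lift_definition zero_tet :: "'a tet" is Zero .
lift_definition plus_tet :: "'a tet \<Rightarrow> 'a tet \<Rightarrow> 'a tet" is Add by (rule lie_eq.cong_add)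
lift_definition uminus_tet :: "'a tet \<Rightarrow> 'a tet" is "Scale (-1)" by (rule lie_eq.cong_scale)
definition minus_tet :: "'a tet \<Rightarrow> 'a tet \<Rightarrow> 'a tet" where "minus_tet s t = s + - t"

instance
proof
  fix s t u :: "'a tet"
  show "s + t + u = s + (t + u)" by transfer (rule lie_eq.add_assoc)
  show "s + t = t + s" by transfer (rule lie_eq.add_comm)
  show "0 + t = t" by transfer (rule lie_eq.add_zero)
  show "- t + t = 0" by transfer (rule lie_eq.add_neg)
  show "s - t = s + - t" by (rule minus_tet_def)
qed

end

lift_definition tet_scale :: "'k::field \<Rightarrow> 'k tet \<Rightarrow> 'k tet" is Scale by (rule lie_eq.cong_scale)

lift_definition tet_bracket :: "'k::field tet \<Rightarrow> 'k tet \<Rightarrow> 'k tet" is Bracket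
  by (rule lie_eq.cong_bracket)

text \<open>\<open>tet_x i j\<close> is meaningful only for distinct \<open>i\<close>, \<open>j\<close> in \<open>tet_index\<close>.\<close>

lift_definition tet_x :: "nat \<Rightarrow> nat \<Rightarrow> 'k::field tet" is tet_X .

lemma lie_algebra_tet: "lie_algebra tet_scale tet_bracket"
  by (unfold_locales; transfer;
      rule lie_eq.scale_add lie_eq.add_scale lie_eq.scale_scale lie_eq.scale_one
        lie_eq.br_add_left lie_eq.br_add_right lie_eq.br_scale_left lie_eq.br_scale_right
        lie_eq.br_self lie_eq.br_jacobi)

lemma tet_rel1:
  assumes "i \<in> tet_index" "j \<in> tet_index" "i \<noteq> j"
  shows "tet_x i j + tet_x j i = 0"
  using assms by transfer (rule lie_eq.rel, force simp: tet_rels_def)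

lemma tet_rel2:
  assumes "{i, j, k} \<subseteq> tet_index" "distinct [i, j, k]"
  shows "tet_bracket (tet_x i j) (tet_x j k) = tet_scale 2 (tet_x i j) + tet_scale 2 (tet_x j k)"
  using assms by transfer (rule lie_eq.rel, unfold tet_rels_def, blast)

lemma tet_rel3:
  assumes "{i, j, k, l} \<subseteq> tet_index" "distinct [i, j, k, l]"
  shows "tet_bracket (tet_x i j) (tet_bracket (tet_x i j) (tet_bracket (tet_x i j) (tet_x k l)))
    = tet_scale 4 (tet_bracket (tet_x i j) (tet_x k l))"
  using assms by transfer (rule lie_eq.rel, unfold tet_rels_def, blast)

section \<open>The Lie algebra sl2\<close>

text \<open>\<open>Sl2 p q r\<close> stands for \<open>p e + q f + r h\<close>.\<close>

datatype 'k sl2 = Sl2 (coeff_e: 'k) (coeff_f: 'k) (coeff_h: 'k)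

instantiation sl2 :: (ab_group_add) ab_group_add
begin

definition "0 = Sl2 0 0 0"
definition "u + v = Sl2 (coeff_e u + coeff_e v) (coeff_f u + coeff_f v) (coeff_h u + coeff_h v)"
definition "- u = Sl2 (- coeff_e u) (- coeff_f u) (- coeff_h u)"
definition "u - v = Sl2 (coeff_e u - coeff_e v) (coeff_f u - coeff_f v) (coeff_h u - coeff_h v)"

instance
  by standard
    (simp_all add: zero_sl2_def plus_sl2_def uminus_sl2_def minus_sl2_def sl2.expand algebra_simps)

end

definition sl2_scale :: "'k::field \<Rightarrow> 'k sl2 \<Rightarrow> 'k sl2"
  where "sl2_scale c u = Sl2 (c * coeff_e u) (c * coeff_f u) (c * coeff_h u)"

text \<open>The bilinear alternating extension of \<open>[h, e] = 2e\<close>, \<open>[h, f] = -2f\<close>, \<open>[e, f] = h\<close>.\<close>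

definition sl2_bracket :: "'k::field sl2 \<Rightarrow> 'k sl2 \<Rightarrow> 'k sl2"
  where "sl2_bracket u v =
    Sl2 (2 * (coeff_h u * coeff_e v - coeff_e u * coeff_h v))
        (2 * (coeff_f u * coeff_h v - coeff_h u * coeff_f v))
        (coeff_e u * coeff_f v - coeff_f u * coeff_e v)"

lemmas sl2_simps = zero_sl2_def plus_sl2_def uminus_sl2_def minus_sl2_def
  sl2_scale_def sl2_bracket_def

lemma lie_algebra_sl2: "lie_algebra sl2_scale sl2_bracket"
  by unfold_locales (simp_all add: sl2_simps algebra_simps)

definition sl2_e :: "'k::field sl2" where "sl2_e = Sl2 1 0 0"
definition sl2_f :: "'k::field sl2" where "sl2_f = Sl2 0 1 0"
definition sl2_h :: "'k::field sl2" where "sl2_h = Sl2 0 0 1"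

lemma sl2_brackets:
  "sl2_bracket sl2_h sl2_e = sl2_scale 2 sl2_e"
  "sl2_bracket sl2_h sl2_f = sl2_scale (-2) sl2_f"
  "sl2_bracket sl2_e sl2_f = sl2_h"
  by (simp_all add: sl2_simps sl2_e_def sl2_f_def sl2_h_def)

definition sl2_x :: "'k::field sl2" where "sl2_x = sl2_scale 2 sl2_e - sl2_h"
definition sl2_y :: "'k::field sl2" where "sl2_y = sl2_scale (-2) sl2_f - sl2_h"
definition sl2_z :: "'k::field sl2" where "sl2_z = sl2_h"

section \<open>The evaluation homomorphism\<close>

definition is_EV :: "'k::field \<Rightarrow> ('k tet \<Rightarrow> 'k sl2) \<Rightarrow> bool"
  where "is_EV a \<phi> \<longleftrightarrow> lie_hom tet_scale tet_bracket sl2_scale sl2_bracket \<phi> \<and>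
    \<phi> (tet_x 1 2) = sl2_x \<and>
    \<phi> (tet_x 2 3) = sl2_y \<and>
    \<phi> (tet_x 3 1) = sl2_z \<and>
    \<phi> (tet_x 0 3) = sl2_scale a sl2_y + sl2_scale (a - 1) sl2_z \<and>
    \<phi> (tet_x 0 1) = sl2_scale (1 - inverse a) sl2_z - sl2_scale (inverse a) sl2_x \<and>
    \<phi> (tet_x 0 2) = sl2_scale (inverse (1 - a)) sl2_x + sl2_scale (a * inverse (1 - a)) sl2_y"

text \<open>Well defined for \<open>a \<notin> {0, 1}\<close>, see \<open>ex1_EV\<close> below.\<close>

definition EV :: "'k::field \<Rightarrow> 'k tet \<Rightarrow> 'k sl2"
  where "EV a = (THE \<phi>. is_EV a \<phi>)"

fun EV_gen :: "'k::field \<Rightarrow> nat \<times> nat \<Rightarrow> 'k sl2"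
  where "EV_gen a (i, j) =
   (let x03 = sl2_scale a sl2_y + sl2_scale (a - 1) sl2_z;
        x01 = sl2_scale (1 - inverse a) sl2_z - sl2_scale (inverse a) sl2_x;
        x02 = sl2_scale (inverse (1 - a)) sl2_x + sl2_scale (a * inverse (1 - a)) sl2_y
    in if (i, j) = (1, 2) then sl2_x else if (i, j) = (2, 1) then - sl2_x
       else if (i, j) = (2, 3) then sl2_y else if (i, j) = (3, 2) then - sl2_y
       else if (i, j) = (3, 1) then sl2_z else if (i, j) = (1, 3) then - sl2_z
       else if (i, j) = (0, 3) then x03 else if (i, j) = (3, 0) then - x03
       else if (i, j) = (0, 1) then x01 else if (i, j) = (1, 0) then - x01
       else if (i, j) = (0, 2) then x02 else - x02)"

abbreviation EV_term :: "'k::field \<Rightarrow> (tet_gen, 'k) lie_term \<Rightarrow> 'k sl2"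
  where "EV_term a \<equiv> lie_term_eval sl2_scale (+) sl2_bracket (\<lambda>g. EV_gen a (Rep_tet_gen g))"

lemma EV_term_X:
  assumes "i \<in> tet_index" "j \<in> tet_index" "i \<noteq> j"
  shows "EV_term a (tet_X i j) = EV_gen a (i, j)"
  using assms by (simp add: tet_X_def Abs_tet_gen_inverse del: EV_gen.simps)

lemma EV_gen_coords:
  fixes a :: "'k::field"
  defines "q \<equiv> inverse (1 - a)"
  shows "EV_gen a (1, 2) = Sl2 2 0 (-1)" "EV_gen a (2, 1) = Sl2 (-2) 0 1"
    "EV_gen a (2, 3) = Sl2 0 (-2) (-1)" "EV_gen a (3, 2) = Sl2 0 2 1"
    "EV_gen a (3, 1) = Sl2 0 0 1" "EV_gen a (1, 3) = Sl2 0 0 (-1)"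
    "EV_gen a (0, 3) = Sl2 0 (-2 * a) (-1)" "EV_gen a (3, 0) = Sl2 0 (2 * a) 1"
    "EV_gen a (0, 1) = Sl2 (-2 * inverse a) 0 1" "EV_gen a (1, 0) = Sl2 (2 * inverse a) 0 (-1)"
    "EV_gen a (0, 2) = Sl2 (2 * q) (-2 * a * q) (- (1 + a) * q)"
    "EV_gen a (2, 0) = Sl2 (-2 * q) (2 * a * q) ((1 + a) * q)"
  unfolding q_def
  by (simp_all add: Let_def sl2_simps sl2_x_def sl2_y_def sl2_z_def sl2_e_def sl2_f_def
        sl2_h_def algebra_simps)

lemma sl2_ad_cubed:
  assumes "coeff_e u * coeff_f u + coeff_h u * coeff_h u = 1"
  shows "sl2_bracket u (sl2_bracket u (sl2_bracket u v)) = sl2_scale 4 (sl2_bracket u v)"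
proof -
  obtain p q r where u: "u = Sl2 p q r" by (cases u)
  obtain x y z where v: "v = Sl2 x y z" by (cases v)
  have "p * q + r * r = 1" using assms u by simp
  then show ?thesis
    unfolding u v sl2_bracket_def sl2_scale_def sl2.sel sl2.inject
    by (intro conjI) algebra+
qed

lemma EV_gen_quadric:
  fixes a :: "'k::field"
  assumes "a \<noteq> 0" "a \<noteq> 1"
  shows "\<forall>i\<in>tet_index. \<forall>j\<in>tet_index. i \<noteq> j \<longrightarrow>
    (let u = EV_gen a (i, j) in coeff_e u * coeff_f u + coeff_h u * coeff_h u = 1)"
proof -
  define q where q: "q = inverse (1 - a)"
  have "(1 - a) * q = 1" using assms by (simp add: q)
  then have "(1 + a) * q * ((1 + a) * q) - 4 * (q * (a * q)) = 1"
    "(- 1 - a) * q * ((- 1 - a) * q) - 4 * (q * (a * q)) = 1" by algebra+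
  then show ?thesis
    by (simp add: tet_index_def EV_gen_coords[unfolded One_nat_def] flip: q del: EV_gen.simps)
qed

lemma EV_gen_rel2:
  fixes a :: "'k::field"
  assumes "a \<noteq> 0" "a \<noteq> 1"
  shows "\<forall>i\<in>tet_index. \<forall>j\<in>tet_index. \<forall>k\<in>tet_index. distinct [i, j, k] \<longrightarrow>
    sl2_bracket (EV_gen a (i, j)) (EV_gen a (j, k))
      = sl2_scale 2 (EV_gen a (i, j)) + sl2_scale 2 (EV_gen a (j, k))"
proof -
  define p q where "p = inverse a" and "q = inverse (1 - a)"
  have pq: "a * p = 1" "(1 - a) * q = 1" using assms by (simp_all add: p_def q_def)
  note coords = EV_gen_coords[of a, unfolded One_nat_def, folded p_def q_def]
  show ?thesis
    apply (simp add: tet_index_def coords sl2_simps del: EV_gen.simps)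
    apply (intro conjI)
     apply (use pq in algebra)+
    done
qed

lemma EV_term_rels:
  assumes a: "a \<noteq> 0" "a \<noteq> 1" and st: "(s, t) \<in> tet_rels"
  shows "EV_term a s = EV_term a t"
  using st unfolding tet_rels_def
proof (elim UnE CollectE exE conjE)
  fix i j
  assume "(s, t) = (Add (tet_X i j) (tet_X j i), Zero)" "{i, j} \<subseteq> tet_index" "distinct [i, j]"
  then show ?thesis
    by (simp add: EV_term_X del: EV_gen.simps)
      (auto simp: tet_index_def EV_gen_coords[unfolded One_nat_def] sl2_simps
        simp flip: distrib_right simp del: EV_gen.simps)
next
  fix i j k
  assume "(s, t) = (Bracket (tet_X i j) (tet_X j k),
      Add (Scale 2 (tet_X i j)) (Scale 2 (tet_X j k)))"
    and "{i, j, k} \<subseteq> tet_index" "distinct [i, j, k]"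
  then show ?thesis
    using EV_gen_rel2[OF a] by (simp add: EV_term_X del: EV_gen.simps)
next
  fix i j k l
  assume st: "(s, t) = (Bracket (tet_X i j) (Bracket (tet_X i j) (Bracket (tet_X i j) (tet_X k l))),
      Scale 4 (Bracket (tet_X i j) (tet_X k l)))"
    and ijkl: "{i, j, k, l} \<subseteq> tet_index" "distinct [i, j, k, l]"
  have "sl2_bracket (EV_gen a (i, j)) (sl2_bracket (EV_gen a (i, j))
          (sl2_bracket (EV_gen a (i, j)) v))
        = sl2_scale 4 (sl2_bracket (EV_gen a (i, j)) v)" for v
    using EV_gen_quadric[OF a] ijkl by (intro sl2_ad_cubed) (simp add: Let_def del: EV_gen.simps)
  with st ijkl show ?thesis by (simp add: EV_term_X del: EV_gen.simps)
qed

lemma tet_induct: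
  fixes P :: "'k::field tet \<Rightarrow> bool"
  assumes "\<And>i j. i \<in> tet_index \<Longrightarrow> j \<in> tet_index \<Longrightarrow> i \<noteq> j \<Longrightarrow> P (tet_x i j)"
    and "P 0" and "\<And>s t. P s \<Longrightarrow> P t \<Longrightarrow> P (s + t)"
    and "\<And>c t. P t \<Longrightarrow> P (tet_scale c t)"
    and "\<And>s t. P s \<Longrightarrow> P t \<Longrightarrow> P (tet_bracket s t)"
  shows "P t"
proof -
  have "P (abs_tet u)" for u :: "(tet_gen, 'k) lie_term"
  proof (induction u)
    case (Gen g)
    obtain i j where g: "g = Abs_tet_gen (i, j)" "i \<in> tet_index" "j \<in> tet_index" "i \<noteq> j"
      by (cases g) auto
    then show ?case using assms(1)[of i j] by (simp add: tet_x_def tet_X_def)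
  qed (use assms in \<open>simp_all add: zero_tet_def plus_tet.abs_eq[symmetric]
      tet_scale.abs_eq[symmetric] tet_bracket.abs_eq[symmetric]\<close>)
  then show ?thesis using Quotient_tet by (metis Quotient_abs_rep)
qed

lemma lie_homD:
  assumes "lie_hom s b s' b' \<phi>"
  shows "\<phi> (x + y) = \<phi> x + \<phi> y" "\<phi> 0 = 0" "\<phi> (- x) = - \<phi> x" "\<phi> (s c x) = s' c (\<phi> x)"
    "\<phi> (b x y) = b' (\<phi> x) (\<phi> y)"
proof -
  interpret Vector_Spaces.linear s s' \<phi> using assms by (simp add: lie_hom_def)
  show "\<phi> (x + y) = \<phi> x + \<phi> y" "\<phi> 0 = 0" "\<phi> (- x) = - \<phi> x" "\<phi> (s c x) = s' c (\<phi> x)"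
    by (rule add zero neg scale)+
  show "\<phi> (b x y) = b' (\<phi> x) (\<phi> y)" using assms by (simp add: lie_hom_def)
qed

lemma is_EV_gen:
  assumes "is_EV a \<phi>" "i \<in> tet_index" "j \<in> tet_index" "i \<noteq> j"
  shows "\<phi> (tet_x i j) = EV_gen a (i, j)"
proof -
  have hom: "lie_hom tet_scale tet_bracket sl2_scale sl2_bracket \<phi>"
    using assms(1) by (simp add: is_EV_def)
  have rev: "\<phi> (tet_x j i) = - \<phi> (tet_x i j)" if "i \<in> tet_index" "j \<in> tet_index" "i \<noteq> j" for i j
    using tet_rel1[OF that] lie_homD(1,2)[OF hom] by (metis add_eq_0_iff)
  have I: "0 \<in> tet_index" "1 \<in> tet_index" "2 \<in> tet_index" "3 \<in> tet_index"
    by (auto simp: tet_index_def)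
  note revs = rev[of 1 2] rev[of 2 3] rev[of 3 1] rev[of 0 3] rev[of 0 1] rev[of 0 2]
  have "(i = 0 \<or> i = 1 \<or> i = 2 \<or> i = 3) \<and> (j = 0 \<or> j = 1 \<or> j = 2 \<or> j = 3)"
    using assms(2,3) by (auto simp: tet_index_def)
  then show ?thesis using assms(1,4) revs I unfolding is_EV_def by (elim conjE disjE) simp_all
qed

theorem ex1_EV:
  assumes a: "a \<noteq> 0" "a \<noteq> 1"
  shows "\<exists>!\<phi>. is_EV a \<phi>"
proof (rule ex_ex1I)
  interpret S: lie_algebra "sl2_scale :: 'a \<Rightarrow> _" sl2_bracket by (rule lie_algebra_sl2)
  interpret T: lie_algebra "tet_scale :: 'a \<Rightarrow> _" tet_bracket by (rule lie_algebra_tet)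
  define \<phi> where "\<phi> = (\<lambda>t. EV_term a (rep_tet t))"
  have abs: "\<phi> (abs_tet u) = EV_term a u" for u
  proof -
    have "lie_eq tet_rels (rep_tet (abs_tet u)) u"
      using Quotient3_rep_abs[OF Quotient3_tet] lie_eq.refl by blast
    then show ?thesis unfolding \<phi>_def by (rule S.lie_eq_eval) (rule EV_term_rels[OF a])
  qed
  have surj: "\<exists>u. t = abs_tet u" for t :: "'a tet"
    by (metis Quotient_tet Quotient_abs_rep)
  have X: "\<phi> (tet_x i j) = EV_gen a (i, j)"
    if "i \<in> tet_index" "j \<in> tet_index" "i \<noteq> j" for i j
    using EV_term_X[OF that, of a] by (simp add: tet_x_def abs del: EV_gen.simps)
  have add: "\<phi> (s + t) = \<phi> s + \<phi> t" for s t
    using surj[of s] surj[of t] by (auto simp: plus_tet.abs_eq abs)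
  have scale: "\<phi> (tet_scale c t) = sl2_scale c (\<phi> t)" for c t
    using surj[of t] by (auto simp: tet_scale.abs_eq abs)
  have bracket: "\<phi> (tet_bracket s t) = sl2_bracket (\<phi> s) (\<phi> t)" for s t
    using surj[of s] surj[of t] by (auto simp: tet_bracket.abs_eq abs)
  have "lie_hom tet_scale tet_bracket sl2_scale sl2_bracket \<phi>"
    unfolding lie_hom_def Vector_Spaces.linear_def module_hom_def module_hom_axioms_def
    using add scale bracket S.vector_space_axioms T.vector_space_axioms
      S.module_axioms T.module_axioms by auto
  then show "\<exists>\<phi>. is_EV a \<phi>"
    unfolding is_EV_def by (intro exI[of _ \<phi>]) (simp add: X tet_index_def)
next
  fix \<phi> \<psi> assume \<phi>: "is_EV a \<phi>" and \<psi>: "is_EV a \<psi>"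
  then have hom: "lie_hom tet_scale tet_bracket sl2_scale sl2_bracket \<phi>"
    "lie_hom tet_scale tet_bracket sl2_scale sl2_bracket \<psi>" by (simp_all add: is_EV_def)
  have "\<phi> t = \<psi> t" for t
    by (induction t rule: tet_induct)
      (simp_all add: is_EV_gen[OF \<phi>] is_EV_gen[OF \<psi>] lie_homD[OF hom(1)] lie_homD[OF hom(2)]
        del: EV_gen.simps)
  then show "\<phi> = \<psi>" by blast
qed

corollary is_EV_EV: "a \<noteq> 0 \<Longrightarrow> a \<noteq> 1 \<Longrightarrow> is_EV a (EV a)"
  unfolding EV_def by (rule theI'[OF ex1_EV])

section \<open>The irreducible sl2-modules and the evaluation modules\<close>

text \<open>
  \<open>V\<^sub>d\<close> is realised on the polynomials of degree at most \<open>d\<close> (binary forms of degree \<open>d\<close>,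
  dehomogenised), with \<open>e = d/dX\<close>, \<open>f = d X - X\<^sup>2 d/dX\<close> and \<open>h = d - 2 X d/dX\<close>. In particular
  \<open>X\<^sup>i\<close> has weight \<open>d - 2i\<close>.
\<close>

definition sl2_V :: "nat \<Rightarrow> 'k::field poly set"
  where "sl2_V d = {p. degree p \<le> d}"

definition sl2_act :: "nat \<Rightarrow> 'k::field sl2 \<Rightarrow> 'k poly \<Rightarrow> 'k poly"
  where "sl2_act d u p =
    smult (coeff_e u) (pderiv p) +
    smult (coeff_f u) (smult (of_nat d) (monom 1 1 * p) - monom 1 2 * pderiv p) +
    smult (coeff_h u) (smult (of_nat d) p - smult 2 (monom 1 1 * pderiv p))"

definition evaluation_act :: "nat \<Rightarrow> 'k::field \<Rightarrow> 'k tet \<Rightarrow> 'k poly \<Rightarrow> 'k poly"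
  where "evaluation_act d a t = sl2_act d (EV a t)"

lemma vector_space_smult: "vector_space (smult :: 'k::field \<Rightarrow> _)"
  by unfold_locales (simp_all add: smult_add_right smult_add_left)

lemma sl2_V_eq: "sl2_V d = {p. \<forall>i>d. coeff p i = 0}"
  by (auto simp: sl2_V_def coeff_eq_0 intro: degree_le)

lemma coeff_sl2_act:
  "coeff (sl2_act d u p) i =
    coeff_e u * of_nat (Suc i) * coeff p (Suc i) +
    coeff_f u * (if i = 0 then 0 else (of_nat d - of_nat (i - 1)) * coeff p (i - 1)) +
    coeff_h u * (of_nat d - 2 * of_nat i) * coeff p i"
proof -
  have "coeff (monom 1 1 * q) i = (if i = 0 then 0 else coeff q (i - 1))" for q :: "'a poly"
    by (simp add: coeff_monom_mult)
  moreover have "coeff (monom 1 2 * q) i = (if i < 2 then 0 else coeff q (i - 2))" for q :: "'a poly"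
    by (simp add: coeff_monom_mult)
  moreover have "i = 0 \<or> i = 1 \<or> (\<exists>j. i = Suc (Suc j))" by presburger
  ultimately show ?thesis
    by (auto simp: sl2_act_def coeff_pderiv algebra_simps)
qed

lemma lie_module_sl2_V: "lie_module sl2_scale sl2_bracket smult (sl2_V d) (sl2_act d)"
proof -
  interpret S: lie_algebra "sl2_scale :: 'a \<Rightarrow> _" sl2_bracket by (rule lie_algebra_sl2)
  interpret P: vector_space "smult :: 'a \<Rightarrow> _" by (rule vector_space_smult)
  show ?thesis
  proof unfold_locales
    show "P.subspace (sl2_V d)" by (auto simp: P.subspace_def sl2_V_eq)
    show "sl2_act d x v \<in> sl2_V d" if "v \<in> sl2_V d" for x :: "'a sl2" and v
    proof -
      have "coeff (sl2_act d x v) i = 0" if i: "i > d" for i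
      proof (cases "i = Suc d")
        case True
        then show ?thesis using \<open>v \<in> sl2_V d\<close> by (simp add: coeff_sl2_act sl2_V_eq)
      next
        case False
        then have "i - 1 > d" using i by simp
        then show ?thesis using \<open>v \<in> sl2_V d\<close> i by (simp add: coeff_sl2_act sl2_V_eq)
      qed
      then show ?thesis by (simp add: sl2_V_eq)
    qed
    show "sl2_act d (sl2_bracket x y) v = sl2_act d x (sl2_act d y v) - sl2_act d y (sl2_act d x v)"
      for x y :: "'a sl2" and v
    proof (rule poly_eqI)
      fix i
      consider "i = 0" | "i = 1" | j where "i = Suc (Suc j)"
        by (metis One_nat_def not0_implies_Suc)
      then show "coeff (sl2_act d (sl2_bracket x y) v) i =
          coeff (sl2_act d x (sl2_act d y v) - sl2_act d y (sl2_act d x v)) i"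
        by cases (simp_all add: coeff_sl2_act sl2_bracket_def algebra_simps)
    qed
  qed (simp_all add: poly_eq_iff coeff_sl2_act plus_sl2_def sl2_scale_def algebra_simps)
qed

lemma dim_sl2_V: "vector_space.dim smult (sl2_V d :: 'k::field poly set) = d + 1"
proof -
  interpret P: vector_space "smult :: 'k \<Rightarrow> _" by (rule vector_space_smult)
  let ?B = "(\<lambda>i. monom (1::'k) i) ` {..d}"
  have inj: "inj_on (\<lambda>i. monom (1::'k) i) {..d}"
    by (auto simp: inj_on_def monom_eq_iff')
  have "sl2_V d \<subseteq> P.span ?B"
  proof
    fix p :: "'k poly" assume p: "p \<in> sl2_V d"
    have "p = (\<Sum>i\<le>d. monom (coeff p i) i)"
      using p by (auto simp: sl2_V_def poly_as_sum_of_monoms')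
    also have "\<dots> = (\<Sum>i\<le>d. smult (coeff p i) (monom 1 i))" by (simp add: smult_monom)
    also have "\<dots> \<in> P.span ?B"
      by (intro P.span_sum P.span_scale P.span_base) auto
    finally show "p \<in> P.span ?B" .
  qed
  moreover have "P.independent ?B"
  proof (rule P.independent_if_scalars_zero)
    fix c x assume 0: "(\<Sum>x\<in>?B. smult (c x) x) = 0" and x: "x \<in> ?B"
    obtain i where i: "x = monom 1 i" "i \<le> d" using x by auto
    have "0 = coeff (\<Sum>j\<le>d. smult (c (monom 1 j)) (monom 1 j)) i"
      using 0 by (simp add: sum.reindex[OF inj])
    also have "\<dots> = c x" using i by (simp add: coeff_sum sum.delta if_distrib cong: if_cong)
    finally show "c x = 0" by simp
  qed simp
  moreover have "?B \<subseteq> sl2_V d" by (auto simp: sl2_V_def degree_monom_eq)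
  ultimately show ?thesis
    using P.dim_unique[of ?B "sl2_V d" "d + 1"] inj by (simp add: card_image)
qed

lemma irreducible_sl2_V:
  "irreducible_module smult (sl2_V d :: 'k::field_char_0 poly set) (sl2_act d)"
proof -
  interpret P: vector_space "smult :: 'k \<Rightarrow> _" by (rule vector_space_smult)
  have "1 \<in> (sl2_V d :: 'k poly set)" by (simp add: sl2_V_def)
  then have nz: "(sl2_V d :: 'k poly set) \<noteq> {0}" by auto
  have "U = sl2_V d" if sub: "submodule smult (sl2_V d) (sl2_act d) U" and U0: "U \<noteq> {0}"
    for U :: "'k poly set"
  proof -
    have U: "P.subspace U" "U \<subseteq> sl2_V d" "\<And>x u. u \<in> U \<Longrightarrow> sl2_act d x u \<in> U"
      using sub by (auto simp: submodule_def)
    have one: "1 \<in> U" if "p \<in> U" "p \<noteq> 0" for p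
      using that
    proof (induction "degree p" arbitrary: p)
      case 0
      then obtain c where c: "p = [:c:]" "c \<noteq> 0" by (metis degree_eq_zeroE pCons_0_0)
      have "smult (inverse c) p \<in> U" using U(1) 0 by (simp add: P.subspace_scale)
      moreover have "smult (inverse c) p = 1" using c by (simp add: one_pCons)
      ultimately show ?case by simp
    next
      case (Suc n)
      have "sl2_act d sl2_e p = pderiv p" by (simp add: sl2_act_def sl2_e_def)
      then have "pderiv p \<in> U" using U(3)[of p sl2_e] Suc by simp
      moreover have "degree (pderiv p) = n" using Suc by (simp add: degree_pderiv)
      moreover have "pderiv p \<noteq> 0" using Suc by (simp add: pderiv_eq_0_iff)
      ultimately show ?case using Suc by blast
    qed
    have "0 \<in> U" using U(1) by (rule P.subspace_0)
    then have "1 \<in> U" using U0 one by blast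
    have mon: "monom 1 i \<in> U" if "i \<le> d" for i
      using that
    proof (induction i)
      case 0
      then show ?case using \<open>1 \<in> U\<close> by simp
    next
      case (Suc i)
      let ?c = "of_nat d - of_nat i :: 'k"
      have c: "?c \<noteq> 0" using Suc by simp
      have "sl2_act d sl2_f (monom 1 i) = smult ?c (monom 1 (Suc i))"
        by (rule poly_eqI) (auto simp: coeff_sl2_act sl2_f_def)
      then have "smult ?c (monom 1 (Suc i)) \<in> U" using U(3)[of "monom 1 i" sl2_f] Suc by simp
      then have "smult (inverse ?c) (smult ?c (monom 1 (Suc i))) \<in> U"
        using U(1) by (rule P.subspace_scale[rotated])
      then show ?case using c by simp
    qed
    have "sl2_V d \<subseteq> U"
    proof
      fix p :: "'k poly" assume p: "p \<in> sl2_V d"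
      have "p = (\<Sum>i\<le>d. monom (coeff p i) i)"
        using p by (auto simp: sl2_V_def poly_as_sum_of_monoms')
      also have "\<dots> = (\<Sum>i\<le>d. smult (coeff p i) (monom 1 i))" by (simp add: smult_monom)
      also have "\<dots> \<in> U" using U(1) mon by (intro P.subspace_sum P.subspace_scale) auto
      finally show "p \<in> U" .
    qed
    then show ?thesis using U(2) by blast
  qed
  then show ?thesis unfolding irreducible_module_def using nz by blast
qed

lemma lie_module_evaluation:
  assumes "a \<noteq> 0" "a \<noteq> 1"
  shows "lie_module tet_scale tet_bracket smult (sl2_V d) (evaluation_act d a)"
proof -
  interpret M: lie_module sl2_scale sl2_bracket smult "sl2_V d" "sl2_act d :: 'a sl2 \<Rightarrow> _"
    by (rule lie_module_sl2_V)
  interpret T: lie_algebra "tet_scale :: 'a \<Rightarrow> _" tet_bracket by (rule lie_algebra_tet)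
  have "lie_hom tet_scale tet_bracket sl2_scale sl2_bracket (EV a)"
    using is_EV_EV[OF assms] by (simp add: is_EV_def)
  note hom = lie_homD[OF this]
  show ?thesis
    by unfold_locales
      (simp_all add: evaluation_act_def hom M.subspace_V M.act_closed M.act_add_left
        M.act_scale_left M.act_add_right M.act_scale_right M.act_bracket)
qed

end

theory Submission
  imports Defs
begin

text \<open>
  The elements \<open>x\<^sub>1\<^sub>2, x\<^sub>2\<^sub>3, x\<^sub>3\<^sub>1\<close> satisfy the relations of the basis \<open>x, y, z\<close> of \<open>sl2\<close>, which
  gives a homomorphism \<open>\<sigma>\<close> from \<open>sl2\<close> to the tetrahedron algebra with \<open>EV a \<circ> \<sigma> = id\<close>. If the
  four elements vanish on \<open>V\<close>, then \<open>x\<^sub>0\<^sub>1, x\<^sub>0\<^sub>2, x\<^sub>0\<^sub>3\<close> act on \<open>V\<close> as the linear combinations of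
  \<open>x\<^sub>1\<^sub>2, x\<^sub>2\<^sub>3, x\<^sub>3\<^sub>1\<close> prescribed by \<open>EV a\<close>, so every \<open>t\<close> acts as \<open>\<sigma> (EV a t)\<close>. Thus \<open>V\<close> is the
  pullback along \<open>EV a\<close> of an irreducible \<open>sl2\<close>-module, which is \<open>V\<^sub>d\<close> by highest weight theory,
  and \<open>d \<noteq> 0\<close> because \<open>V\<close> is nontrivial. Conversely, \<open>EV a\<close> maps the four elements to \<open>0\<close>.
\<close>

section \<open>Polynomials in a linear operator\<close>

text \<open>The action of a \<open>lie_module\<close> is constrained only on \<open>V\<close>, so
  the eigenvalue theory is set up for operators known to be linear only there.\<close>

locale subspace_endo = vector_space scale
  for scale :: "'k::field \<Rightarrow> 'v::ab_group_add \<Rightarrow> 'v" +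
  fixes V :: "'v set" and T :: "'v \<Rightarrow> 'v"
  assumes subspace_V: "subspace V"
    and T_closed: "v \<in> V \<Longrightarrow> T v \<in> V"
    and T_add: "v \<in> V \<Longrightarrow> w \<in> V \<Longrightarrow> T (v + w) = T v + T w"
    and T_scale: "v \<in> V \<Longrightarrow> T (scale c v) = scale c (T v)"
begin

lemma T_0: "T 0 = 0"
  using T_scale[of 0 0] subspace_0[OF subspace_V] by simp

text \<open>Horner's scheme for the vector p(T) v. Folding over the coefficients yields the rule for
  \<open>pCons\<close> on which the inductions below rest.\<close>

definition poly_op :: "'k poly \<Rightarrow> 'v \<Rightarrow> 'v"
  where "poly_op p v = fold_coeffs (\<lambda>c w. scale c v + T w) p 0"

lemma poly_op_0 [simp]: "poly_op 0 v = 0"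
  by (simp add: poly_op_def)

lemma poly_op_pCons [simp]: "poly_op (pCons c p) v = scale c v + T (poly_op p v)"
  by (cases "p = 0 \<and> c = 0") (auto simp: poly_op_def T_0)

lemma poly_op_closed: "v \<in> V \<Longrightarrow> poly_op p v \<in> V"
  by (induction p)
    (auto intro: subspace_0 subspace_add subspace_scale T_closed subspace_V)

lemma poly_op_add: "v \<in> V \<Longrightarrow> poly_op (p + q) v = poly_op p v + poly_op q v"
  by (induction p q rule: poly_induct2)
    (simp_all add: T_add poly_op_closed scale_left_distrib algebra_simps)

lemma poly_op_smult: "v \<in> V \<Longrightarrow> poly_op (smult c p) v = scale c (poly_op p v)"
  by (induction p) (simp_all add: T_scale poly_op_closed scale_right_distrib)

lemma poly_op_mult: "v \<in> V \<Longrightarrow> poly_op (p * q) v = poly_op p (poly_op q v)"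
  by (induction p)
    (simp_all add: poly_op_add poly_op_smult poly_op_closed algebra_simps)

lemma poly_op_add_right:
  assumes "v \<in> V" "w \<in> V"
  shows "poly_op p (v + w) = poly_op p v + poly_op p w"
  using assms
  by (induction p) (simp_all add: T_add poly_op_closed scale_right_distrib algebra_simps)

lemma poly_op_scale_right:
  assumes "v \<in> V"
  shows "poly_op p (scale c v) = scale c (poly_op p v)"
  using assms
  by (induction p) (simp_all add: T_scale poly_op_closed scale_right_distrib mult.commute)

lemma poly_op_0_right: "poly_op p 0 = 0"
  using poly_op_scale_right[of 0 p 0] subspace_0[OF subspace_V] by simp

lemma poly_op_sum: "v \<in> V \<Longrightarrow> poly_op (sum g A) v = (\<Sum>i\<in>A. poly_op (g i) v)"
  by (induction A rule: infinite_finite_induct) (simp_all add: poly_op_add)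

lemma poly_op_eigenvector:
  assumes "v \<in> V" "T v = scale c v"
  shows "poly_op p v = scale (poly p c) v"
  using assms by (induction p) (simp_all add: T_scale scale_left_distrib mult.commute)

text \<open>The vectors T^i v with i <= \<open>card B\<close> number one more than the spanning set.
  Either two of them coincide, and a difference of monomials annihilates v, or they are distinct and
  hence dependent, and a dependence supplies the coefficients.\<close>

lemma ex_annihilating_poly_vector:
  assumes "fin_dim scale V" and v: "v \<in> V"
  shows "\<exists>p. p \<noteq> 0 \<and> poly_op p v = 0"
proof -
  obtain B where B: "finite B" "V = span B" using assms(1) by (auto simp: fin_dim_def)
  let ?g = "\<lambda>i. poly_op (monom 1 i) v"
  show ?thesis
  proof (cases "inj_on ?g {..card B}")
    case False
    then obtain i j where ij: "i \<noteq> j" "?g i = ?g j" by (auto simp: inj_on_def)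
    have "poly_op (monom 1 i + smult (-1) (monom 1 j)) v = 0"
      using ij v by (simp only: poly_op_add poly_op_smult) simp
    moreover have "monom 1 i + smult (-1) (monom 1 j) \<noteq> (0 :: 'k poly)"
      using ij by (auto simp: poly_eq_iff intro!: exI[of _ i])
    ultimately show ?thesis by blast
  next
    case True
    let ?S = "?g ` {..card B}"
    have "?S \<subseteq> span B" using poly_op_closed[OF v] B by auto
    then have "dependent ?S"
      using independent_span_bound[OF B(1), of ?S] card_image[OF True] by auto
    then obtain u s where u: "s \<in> ?S" "u s \<noteq> 0" "(\<Sum>s\<in>?S. scale (u s) s) = 0"
      using dependent_finite[of ?S] by auto
    let ?p = "\<Sum>i\<le>card B. monom (u (?g i)) i"
    have "poly_op ?p v = (\<Sum>i\<le>card B. scale (u (?g i)) (?g i))"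
      by (simp add: poly_op_sum[OF v] poly_op_smult[OF v, symmetric] smult_monom)
    then have "poly_op ?p v = 0" using u(3) by (simp add: sum.reindex[OF True])
    moreover obtain i where i: "i \<le> card B" "s = ?g i" using u(1) by auto
    then have "coeff ?p i = u s" by (simp add: coeff_sum)
    then have "?p \<noteq> 0" using u(2) by (metis coeff_0)
    ultimately show ?thesis by blast
  qed
qed

text \<open>Multiply polynomials annihilating the vectors of a finite spanning set. Polynomials in T
  commute, so each factor can be moved next to its own vector.\<close>

lemma ex_annihilating_poly:
  assumes "fin_dim scale V"
  shows "\<exists>p. p \<noteq> 0 \<and> (\<forall>v\<in>V. poly_op p v = 0)"
proof -
  obtain B where B: "finite B" "V = span B" using assms(1) by (auto simp: fin_dim_def)
  have "\<exists>p. p \<noteq> 0 \<and> (\<forall>v\<in>C. poly_op p v = 0)" if "finite C" "C \<subseteq> V" for C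
    using that
  proof (induction C rule: finite_induct)
    case empty
    then show ?case by (auto intro: exI[of _ 1])
  next
    case (insert v C)
    then obtain p where p: "p \<noteq> 0" "\<forall>v\<in>C. poly_op p v = 0" by auto
    obtain q where q: "q \<noteq> 0" "poly_op q v = 0"
      using ex_annihilating_poly_vector[OF assms] insert.prems by auto
    have "poly_op (p * q) v = 0"
      using q insert.prems by (simp add: poly_op_mult poly_op_0_right)
    moreover have "poly_op (p * q) w = 0" if "w \<in> C" for w
      using p that insert.prems
      by (subst mult.commute) (simp add: poly_op_mult poly_op_0_right subset_iff)
    ultimately show ?case using p q by (intro exI[of _ "p * q"]) auto
  qed
  then obtain p where p: "p \<noteq> 0" "\<forall>v\<in>B. poly_op p v = 0"
    using B span_superset by metis
  have "v \<in> V \<and> poly_op p v = 0" if "v \<in> span B" for v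
    using that
  proof (induction rule: span_induct_alt)
    case base
    then show ?case using poly_op_0_right subspace_0[OF subspace_V] by simp
  next
    case (step c x y)
    then have "x \<in> V" using B by (simp add: span_base)
    then show ?case using step p
      by (simp add: poly_op_add_right poly_op_scale_right subspace_V subspace_add subspace_scale)
  qed
  then show ?thesis using p B by blast
qed

text \<open>On an eigenvector p(T) acts as the scalar p(c), so every eigenvalue is a root of an
  annihilating polynomial.\<close>

lemma finite_eigenvalues:
  assumes "fin_dim scale V"
  shows "finite {c. \<exists>v\<in>V. v \<noteq> 0 \<and> T v = scale c v}"
proof -
  obtain p where p: "p \<noteq> 0" "\<forall>v\<in>V. poly_op p v = 0"
    using ex_annihilating_poly[OF assms] by blast
  then have "{c. \<exists>v\<in>V. v \<noteq> 0 \<and> T v = scale c v} \<subseteq> {c. poly p c = 0}"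
    using poly_op_eigenvector by fastforce
  then show ?thesis using poly_roots_finite[OF p(1)] finite_subset by blast
qed

text \<open>Algebraic closedness enters as the first assumption. Write a polynomial annihilating v
  as (X - c) q: either q(T) v is an eigenvector, or q annihilates v and has smaller degree.\<close>

lemma ex_eigenvector:
  assumes "\<And>p :: 'k poly. degree p > 0 \<Longrightarrow> \<exists>z. poly p z = 0"
    and "fin_dim scale V" "V \<noteq> {0}"
  shows "\<exists>c. \<exists>v\<in>V. v \<noteq> 0 \<and> T v = scale c v"
proof -
  obtain v where v: "v \<in> V" "v \<noteq> 0" using assms(3) subspace_0[OF subspace_V] by blast
  have "\<exists>c. \<exists>v\<in>V. v \<noteq> 0 \<and> T v = scale c v" if "p \<noteq> 0" "poly_op p v = 0" for p
    using that
  proof (induction "degree p" arbitrary: p)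
    case 0
    then obtain c where "p = [:c:]" "c \<noteq> 0" by (metis degree_eq_zeroE pCons_0_0)
    then show ?case using 0 v by (simp add: T_0)
  next
    case (Suc n)
    then obtain c where "poly p c = 0" using assms(1)[of p] by auto
    then obtain q where q: "p = [:-c, 1:] * q" by (metis poly_eq_0_iff_dvd dvdE)
    then have q0: "q \<noteq> 0" using Suc.prems by auto
    show ?case
    proof (cases "poly_op q v = 0")
      case True
      have "degree p = Suc (degree q)" using q0 unfolding q by (subst degree_mult_eq) auto
      then show ?thesis using Suc True q0 by auto
    next
      case False
      have "poly_op [:-c, 1:] (poly_op q v) = 0"
        using Suc.prems(2) poly_op_mult[OF v(1)] q by metis
      then have "T (poly_op q v) = scale c (poly_op q v)"
        by (simp add: T_0 del: mult_pCons_left)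
      then show ?thesis using False poly_op_closed[OF v(1)] by blast
    qed
  qed
  then show ?thesis using ex_annihilating_poly_vector[OF assms(2) v(1)] by blast
qed

end

section \<open>Homomorphisms of modules\<close>

context lie_module
begin

lemma endo: "subspace_endo scale V (act x)"
  by unfold_locales (simp_all add: subspace_V act_closed act_add_right act_scale_right)

lemma act_0_right: "act x 0 = 0"
  using subspace_endo.T_0[OF endo] .

lemma act_sum_right: "(\<And>i. i \<in> A \<Longrightarrow> g i \<in> V) \<Longrightarrow> act x (sum g A) = (\<Sum>i\<in>A. act x (g i))"
  by (induction A rule: infinite_finite_induct)
    (simp_all add: act_0_right act_add_right subspace_V subspace_sum)

end

text \<open>The isomorphism with \<open>sl2_V\<close> is built from the polynomial side and turned
  around here. Closure of \<open>V\<close> under the operations lets the equations be read backwards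
  through the inverse.\<close>

lemma module_isomorphic_sym:
  assumes V: "lie_module ls b s V act" and "module_isomorphic s V act s' W act'"
  shows "module_isomorphic s' W act' s V act"
proof -
  interpret lie_module ls b s V act by (rule V)
  obtain \<phi> where \<phi>: "bij_betw \<phi> V W" "\<And>v w. v \<in> V \<Longrightarrow> w \<in> V \<Longrightarrow> \<phi> (v + w) = \<phi> v + \<phi> w"
    "\<And>c v. v \<in> V \<Longrightarrow> \<phi> (s c v) = s' c (\<phi> v)" "\<And>x v. v \<in> V \<Longrightarrow> \<phi> (act x v) = act' x (\<phi> v)"
    using assms(2) by (auto simp: module_isomorphic_def)
  define \<psi> where "\<psi> = the_inv_into V \<phi>"
  have inj: "inj_on \<phi> V" and W: "W = \<phi> ` V" using \<phi>(1) by (auto simp: bij_betw_def)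
  have \<psi>: "\<psi> (\<phi> v) = v" if "v \<in> V" for v
    unfolding \<psi>_def using inj that by (rule the_inv_into_f_f)
  have "bij_betw \<psi> W V" unfolding \<psi>_def by (rule bij_betw_the_inv_into[OF \<phi>(1)])
  moreover have "\<psi> (v + w) = \<psi> v + \<psi> w" if "v \<in> W" "w \<in> W" for v w
    using that subspace_add[OF subspace_V]
    by (auto simp: W \<phi>(2)[symmetric] \<psi>)
  moreover have "\<psi> (s' c v) = s c (\<psi> v)" if "v \<in> W" for c v
    using that subspace_scale[OF subspace_V] by (auto simp: W \<phi>(3)[symmetric] \<psi>)
  moreover have "\<psi> (act' x v) = act x (\<psi> v)" if "v \<in> W" for x v
    using that by (auto simp: W \<phi>(4)[symmetric] \<psi> act_closed)
  ultimately show ?thesis unfolding module_isomorphic_def by blast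
qed

text \<open>Schur's lemma: kernel and image are submodules, and one nonzero value forces the kernel
  to be zero and the image to be all of \<open>W\<close>.\<close>

lemma schur_isomorphic:
  assumes V: "lie_module ls b s V act" and W: "lie_module ls b s' W act'"
    and irr: "irreducible_module s V act" "irreducible_module s' W act'"
    and maps: "\<And>v. v \<in> V \<Longrightarrow> \<phi> v \<in> W"
    and add: "\<And>v w. v \<in> V \<Longrightarrow> w \<in> V \<Longrightarrow> \<phi> (v + w) = \<phi> v + \<phi> w"
    and scale: "\<And>c v. v \<in> V \<Longrightarrow> \<phi> (s c v) = s' c (\<phi> v)"
    and act: "\<And>x v. v \<in> V \<Longrightarrow> \<phi> (act x v) = act' x (\<phi> v)"
    and nonzero: "v0 \<in> V" "\<phi> v0 \<noteq> 0"
  shows "module_isomorphic s V act s' W act'"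
proof -
  interpret V: lie_module ls b s V act by (rule V)
  interpret W: lie_module ls b s' W act' by (rule W)
  note Vcl = V.subspace_0[OF V.subspace_V] V.subspace_add[OF V.subspace_V]
    V.subspace_scale[OF V.subspace_V]
  have \<phi>0: "\<phi> 0 = 0" using scale[of 0 0] Vcl by simp
  let ?K = "{v\<in>V. \<phi> v = 0}"
  have "submodule s V act ?K"
    unfolding submodule_def V.subspace_def
    by (auto simp: Vcl \<phi>0 add scale act V.act_closed W.act_0_right)
  then have K: "?K = {0}" using irr(1) nonzero unfolding irreducible_module_def by blast
  have "inj_on \<phi> V"
  proof (rule inj_onI)
    fix v w assume vw: "v \<in> V" "w \<in> V" "\<phi> v = \<phi> w"
    have "\<phi> (v + s (-1) w) = \<phi> v + s' (-1) (\<phi> w)" using vw by (simp only: add scale Vcl)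
    then have "\<phi> (v + s (-1) w) = 0" using vw by simp
    then have "v + s (-1) w \<in> ?K" using vw Vcl by blast
    then show "v = w" using K by simp
  qed
  moreover have "submodule s' W act' (\<phi> ` V)"
    unfolding submodule_def W.subspace_def
  proof (intro conjI ballI allI)
    show "0 \<in> \<phi> ` V" using \<phi>0 Vcl(1) by force
    show "x + y \<in> \<phi> ` V" if "x \<in> \<phi> ` V" "y \<in> \<phi> ` V" for x y
      using that Vcl(2) by (auto simp: add[symmetric])
    show "s' c x \<in> \<phi> ` V" if "x \<in> \<phi> ` V" for c x
      using that Vcl(3) by (auto simp: scale[symmetric])
    show "act' x u \<in> \<phi> ` V" if "u \<in> \<phi> ` V" for x u
      using that V.act_closed by (auto simp: act[symmetric])
  qed (use maps in auto)
  then have "\<phi> ` V = W" using irr(2) nonzero unfolding irreducible_module_def by blast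
  ultimately show ?thesis
    unfolding module_isomorphic_def bij_betw_def using add scale act by blast
qed

section \<open>Irreducible sl2-modules\<close>

locale sl2_module = lie_module sl2_scale sl2_bracket scale V act
  for scale :: "'k::field_char_0 \<Rightarrow> 'v::ab_group_add \<Rightarrow> 'v" and V act
begin

abbreviation "E \<equiv> act sl2_e"
abbreviation "F \<equiv> act sl2_f"
abbreviation "H \<equiv> act sl2_h"

lemma act_eq:
  assumes "v \<in> V"
  shows "act u v = scale (coeff_e u) (E v) + scale (coeff_f u) (F v) + scale (coeff_h u) (H v)"
proof -
  have "u = sl2_scale (coeff_e u) sl2_e + sl2_scale (coeff_f u) sl2_f
      + sl2_scale (coeff_h u) sl2_h"
    by (simp add: sl2_simps sl2_e_def sl2_f_def sl2_h_def)
  then show ?thesis using assms by (metis act_add_left act_scale_left)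
qed

lemma commutators:
  assumes "v \<in> V"
  shows "H (E v) = E (H v) + scale 2 (E v)" "H (F v) = F (H v) - scale 2 (F v)"
    "E (F v) = F (E v) + H v"
proof -
  have "scale 2 (E v) = H (E v) - E (H v)" "scale (-2) (F v) = H (F v) - F (H v)"
    "H v = E (F v) - F (E v)"
    using act_bracket[OF assms] act_scale_left[OF assms] by (metis sl2_brackets)+
  note * = this
  show "H (E v) = E (H v) + scale 2 (E v)" using *(1) by simp
  show "H (F v) = F (H v) - scale 2 (F v)" using *(2) by (simp add: algebra_simps)
  show "E (F v) = F (E v) + H v" using *(3) by simp
qed

lemma funpow_closed: "v \<in> V \<Longrightarrow> (act x ^^ k) v \<in> V"
  by (induction k) (simp_all add: act_closed)

lemma H_E_power:
  assumes "v \<in> V" "H v = scale c v"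
  shows "H ((E ^^ k) v) = scale (c + 2 * of_nat k) ((E ^^ k) v)"
  using assms
  by (induction k) (simp_all add: commutators funpow_closed act_scale_right algebra_simps
      flip: scale_left_distrib)

lemma H_F_power:
  assumes "v \<in> V" "H v = scale c v"
  shows "H ((F ^^ k) v) = scale (c - 2 * of_nat k) ((F ^^ k) v)"
  using assms
  by (induction k) (simp_all add: commutators funpow_closed act_scale_right algebra_simps
      flip: scale_left_diff_distrib scale_left_distrib)

text \<open>Moving \<open>E\<close> to the right past each \<open>F\<close> leaves one
  \<open>H\<close>. These contribute the weights c, c - 2, ..., c - 2k, whose sum is (k + 1)(c -
  k).\<close>

lemma E_F_power:
  assumes "v \<in> V" "H v = scale c v" "E v = 0"
  shows "E ((F ^^ Suc k) v) = scale (of_nat (Suc k) * (c - of_nat k)) ((F ^^ k) v)"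
proof (induction k)
  case 0
  then show ?case using assms by (simp add: commutators act_0_right)
next
  case (Suc k)
  have "E ((F ^^ Suc (Suc k)) v) = F (E ((F ^^ Suc k) v)) + H ((F ^^ Suc k) v)"
    using funpow_closed[OF assms(1), where x = sl2_f and k = "Suc k"] commutators(3) by simp
  also have "\<dots> = scale (of_nat (Suc k) * (c - of_nat k)) ((F ^^ Suc k) v)
      + scale (c - 2 * of_nat (Suc k)) ((F ^^ Suc k) v)"
    using Suc H_F_power[OF assms(1,2), of "Suc k"] funpow_closed[OF assms(1), where x = sl2_f and k = k]
    by (simp add: act_scale_right)
  also have "\<dots> = scale (of_nat (Suc (Suc k)) * (c - of_nat (Suc k))) ((F ^^ Suc k) v)"
    unfolding scale_left_distrib[symmetric] by (simp add: algebra_simps)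
  finally show ?case .
qed

text \<open>Otherwise the scalars c + r k for all k would be eigenvalues of \<open>H\<close>; in
  characteristic 0 they are pairwise distinct, against \<open>finite_eigenvalues\<close>. It is
  applied to \<open>E\<close> with r = 2 and to \<open>F\<close> with r = -2.\<close>

lemma funpow_last_nonzero:
  assumes "fin_dim scale V" "r \<noteq> 0"
    and "\<And>k. H ((act x ^^ k) v) = scale (c + r * of_nat k) ((act x ^^ k) v)"
    and "v \<in> V" "v \<noteq> 0"
  shows "\<exists>k. (act x ^^ Suc k) v = 0 \<and> (act x ^^ k) v \<noteq> 0"
proof (rule ccontr)
  assume step: "\<nexists>k. (act x ^^ Suc k) v = 0 \<and> (act x ^^ k) v \<noteq> 0"
  have "(act x ^^ k) v \<noteq> 0" for k
    using step assms(5) by (induction k) auto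
  then have "range (\<lambda>k. c + r * of_nat k) \<subseteq> {c. \<exists>v\<in>V. v \<noteq> 0 \<and> H v = scale c v}"
    using assms(3) funpow_closed[OF assms(4)] by blast
  then have "finite (range (\<lambda>k. c + r * of_nat k))"
    using subspace_endo.finite_eigenvalues[OF endo assms(1)] finite_subset by blast
  moreover have "inj (\<lambda>k. c + r * of_nat k :: 'k)" using assms(2) by (simp add: inj_def)
  ultimately show False using finite_imageD infinite_UNIV_nat by blast
qed

text \<open>Raise an \<open>H\<close>-eigenvector with \<open>E\<close> to the last nonzero vector
  w, then lower w with \<open>F\<close> to the last nonzero vector; the length of the second chain
  is tied to the weight of w.\<close>

lemma ex_highest_weight_vector:
  assumes "\<And>p :: 'k poly. degree p > 0 \<Longrightarrow> \<exists>z. poly p z = 0"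
    and fd: "fin_dim scale V" and "V \<noteq> {0}"
  obtains d v where "v \<in> V" "v \<noteq> 0" "H v = scale (of_nat d) v" "E v = 0" "(F ^^ Suc d) v = 0"
proof -
  obtain c v where v: "v \<in> V" "v \<noteq> 0" "H v = scale c v"
    using subspace_endo.ex_eigenvector[OF endo assms] by blast
  obtain k where k: "(E ^^ Suc k) v = 0" "(E ^^ k) v \<noteq> 0"
    using funpow_last_nonzero[OF fd _ H_E_power[OF v(1,3)] v(1,2)] by auto
  define w where "w = (E ^^ k) v"
  define m where "m = c + 2 * of_nat k"
  have w: "w \<in> V" "w \<noteq> 0" "H w = scale m w" "E w = 0"
    using k v H_E_power[OF v(1,3)] funpow_closed[OF v(1)] by (simp_all add: w_def m_def)
  have "H ((F ^^ k) w) = scale (m + (-2) * of_nat k) ((F ^^ k) w)" for k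
    using H_F_power[OF w(1,3)] by simp
  from funpow_last_nonzero[OF fd _ this w(1,2)]
  obtain d where d: "(F ^^ Suc d) w = 0" "(F ^^ d) w \<noteq> 0" by auto
  \<comment> \<open>Apply \<open>E\<close> to the vanishing vector F^(d+1) w. As d + 1 is nonzero in
    characteristic 0, the weight m must equal d.\<close>
  have "scale (of_nat (Suc d) * (m - of_nat d)) ((F ^^ d) w) = 0"
    using E_F_power[OF w(1,3,4), of d] d(1) act_0_right by simp
  then have "m = of_nat d" using d(2) by (simp del: of_nat_Suc)
  then show thesis using that w d(1) by blast
qed

text \<open>A linear map out of the polynomials can be written down on coefficients. Once it
  commutes with the action, Schur's lemma makes it bijective, so no independence of the vectors F^i
  v has to be shown.\<close>

theorem isomorphic_sl2_V:
  assumes "\<And>p :: 'k poly. degree p > 0 \<Longrightarrow> \<exists>z. poly p z = 0"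
    and fd: "fin_dim scale V" and irr: "irreducible_module scale V act"
  shows "\<exists>d. module_isomorphic scale V act smult (sl2_V d) (sl2_act d)"
proof -
  interpret P: vector_space "smult :: 'k \<Rightarrow> _" by (rule vector_space_smult)
  have "V \<noteq> {0}" using irr by (simp add: irreducible_module_def)
  then obtain d v where v: "v \<in> V" "v \<noteq> 0" "H v = scale (of_nat d) v" "E v = 0"
    "(F ^^ Suc d) v = 0"
    using ex_highest_weight_vector[OF assms(1) fd] by blast
  text \<open>The factor turns the vectors \<open>F\<^sup>i v\<close> into the images of the monomials \<open>X\<^sup>i\<close>.\<close>
  define w where "w i = scale (fact (d - i) / fact d) ((F ^^ i) v)" for i
  have wV: "w i \<in> V" for i
    using funpow_closed[OF v(1)] subspace_V by (simp add: w_def subspace_scale)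
  have Fw: "F (w i) = scale (of_nat (d - i)) (w (Suc i))" if "i \<le> d" for i
  \<comment> \<open>At i = d both sides are 0: the factor d - i vanishes, and F^(d+1) kills
    \<open>v\<close>.\<close>
  proof (cases "i = d")
    case True
    then show ?thesis using v funpow_closed[OF v(1)] by (simp add: w_def act_scale_right)
  next
    case False
    then have "d - i = Suc (d - Suc i)" using that by simp
    then have "fact (d - i) = of_nat (d - i) * (fact (d - Suc i) :: 'k)" by simp
    then show ?thesis using funpow_closed[OF v(1)] by (simp add: w_def act_scale_right)
  qed
  have Hw: "H (w i) = scale (of_nat d - 2 * of_nat i) (w i)" for i
    using funpow_closed[OF v(1)] H_F_power[OF v(1,3)]
    by (simp add: w_def act_scale_right mult.commute)
  have E0: "E (w 0) = 0" using v by (simp add: w_def)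
  \<comment> \<open>\<open>E_F_power\<close> gives the factor (i + 1)(d - i), whose second part
    turns (d - i - 1)! into the (d - i)! of \<open>w i\<close>.\<close>
  have Ew: "E (w (Suc i)) = scale (of_nat (Suc i)) (w i)" if "i < d" for i
  proof -
    have "d - i = Suc (d - Suc i)" using that by simp
    then have "fact (d - i) = of_nat (d - i) * (fact (d - Suc i) :: 'k)" by simp
    moreover have "of_nat (d - i) = (of_nat d - of_nat i :: 'k)"
      using that by (simp add: of_nat_diff)
    ultimately show ?thesis
      using funpow_closed[OF v(1), where x = sl2_f and k = "Suc i"] E_F_power[OF v(1,3,4), of i]
      by (simp add: w_def act_scale_right mult.commute del: funpow.simps of_nat_Suc)
  qed
  define \<psi> where "\<psi> p = (\<Sum>i\<le>d. scale (coeff p i) (w i))" for p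
  have \<psi>_add: "\<psi> (p + q) = \<psi> p + \<psi> q" for p q
    by (simp add: \<psi>_def scale_left_distrib sum.distrib)
  have \<psi>_scale: "\<psi> (smult c p) = scale c (\<psi> p)" for c p
    by (simp add: \<psi>_def scale_sum_right)
  have \<psi>V: "\<psi> p \<in> V" for p
    unfolding \<psi>_def using subspace_V wV by (intro subspace_sum subspace_scale)
  have act\<psi>: "act u (\<psi> p) = (\<Sum>i\<le>d. scale (coeff p i) (act u (w i)))" for u p
    unfolding \<psi>_def using wV subspace_V
    by (simp add: act_sum_right act_scale_right subspace_scale)
  \<comment> \<open>Differentiation moves the coefficient of X^(d+1) into degree d, where \<psi>
    would see it, so the degree bound on p matters here.\<close>
  have \<psi>e: "\<psi> (sl2_act d sl2_e p) = E (\<psi> p)" if "p \<in> sl2_V d" for p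
  proof (cases d)
    case 0
    then have "\<psi> (sl2_act d sl2_e p) = 0"
      using that by (simp add: \<psi>_def coeff_sl2_act sl2_e_def sl2_V_eq)
    then show ?thesis using 0 E0 by (simp add: act\<psi>)
  next
    case (Suc n)
    have "\<psi> (sl2_act d sl2_e p) = (\<Sum>i\<le>n. scale (of_nat (Suc i) * coeff p (Suc i)) (w i))"
      using that by (simp add: \<psi>_def coeff_sl2_act sl2_e_def sl2_V_eq Suc)
    also have "\<dots> = E (\<psi> p)"
      unfolding act\<psi> unfolding Suc sum.atMost_Suc_shift using E0
      by (auto simp: Ew Suc mult.commute intro!: sum.cong)
    finally show ?thesis .
  qed
  have \<psi>f: "\<psi> (sl2_act d sl2_f p) = F (\<psi> p)" for p
  proof (cases d)
    case 0
    then have "\<psi> (sl2_act d sl2_f p) = 0" by (simp add: \<psi>_def coeff_sl2_act sl2_f_def)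
    then show ?thesis using 0 Fw[of 0] by (simp add: act\<psi>)
  next
    case (Suc n)
    have "\<psi> (sl2_act d sl2_f p)
        = (\<Sum>i\<le>n. scale ((of_nat d - of_nat i) * coeff p i) (w (Suc i)))"
      unfolding \<psi>_def unfolding Suc sum.atMost_Suc_shift
      by (simp add: coeff_sl2_act sl2_f_def)
    also have "\<dots> = F (\<psi> p)"
      unfolding act\<psi> unfolding Suc sum.atMost_Suc using Fw[of d]
      by (auto simp: Fw Suc mult.commute of_nat_diff intro!: sum.cong)
    finally show ?thesis .
  qed
  have \<psi>h: "\<psi> (sl2_act d sl2_h p) = H (\<psi> p)" for p
    unfolding act\<psi> Hw by (simp add: \<psi>_def coeff_sl2_act sl2_h_def mult.commute)
  interpret S: sl2_module smult "sl2_V d :: 'k poly set" "sl2_act d"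
    by (intro sl2_module.intro lie_module_sl2_V)
  have \<psi>_act: "\<psi> (sl2_act d u p) = act u (\<psi> p)" if "p \<in> sl2_V d" for u p
    by (subst act_eq[OF \<psi>V], subst S.act_eq[OF that])
      (simp add: \<psi>_add \<psi>_scale \<psi>e[OF that] \<psi>f \<psi>h)
  \<comment> \<open>The constant 1 goes to the highest weight vector \<open>v\<close>, which is the
    nonzero value that Schur's lemma asks for.\<close>
  have "\<psi> 1 = (\<Sum>i\<le>d. if i = 0 then w 0 else 0)"
    unfolding \<psi>_def by (intro sum.cong) (auto simp: coeff_1)
  then have "\<psi> 1 = v" by (simp add: w_def)
  then have "module_isomorphic smult (sl2_V d) (sl2_act d) scale V act"
    using lie_module_sl2_V lie_module_axioms irreducible_sl2_V irr \<psi>V \<psi>_add \<psi>_scale \<psi>_act v(2)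
    by (intro schur_isomorphic[of sl2_scale sl2_bracket _ _ _ _ _ _ \<psi> 1])
      (simp_all add: sl2_V_def)
  then show ?thesis using module_isomorphic_sym lie_module_sl2_V by blast
qed

end

section \<open>Embedding sl2 into the tetrahedron algebra\<close>

lemma lie_homI:
  assumes "lie_algebra s b" "lie_algebra s' b'"
    and "\<And>x y. \<phi> (x + y) = \<phi> x + \<phi> y" "\<And>c x. \<phi> (s c x) = s' c (\<phi> x)"
    and "\<And>x y. \<phi> (b x y) = b' (\<phi> x) (\<phi> y)"
  shows "lie_hom s b s' b' \<phi>"
proof -
  interpret A: lie_algebra s b by (rule assms)
  interpret B: lie_algebra s' b' by (rule assms)
  show ?thesis
    unfolding lie_hom_def Vector_Spaces.linear_def module_hom_def module_hom_axioms_def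
    using assms(3-) A.vector_space_axioms B.vector_space_axioms A.module_axioms B.module_axioms
    by auto
qed

lemma lie_module_pullback:
  assumes "lie_algebra s b" "lie_hom s b s' b' \<phi>" "lie_module s' b' sc V act"
  shows "lie_module s b sc V (\<lambda>x. act (\<phi> x))"
proof -
  interpret A: lie_algebra s b by (rule assms)
  interpret M: lie_module s' b' sc V act by (rule assms)
  show ?thesis
    by unfold_locales
      (simp_all add: lie_homD[OF assms(2)] M.subspace_V M.act_closed M.act_add_left
        M.act_scale_left M.act_add_right M.act_scale_right M.act_bracket)
qed

text \<open>The homomorphism \<open>\<sigma>\<close>: it sends \<open>sl2_x, sl2_y, sl2_z\<close> to \<open>x\<^sub>1\<^sub>2, x\<^sub>2\<^sub>3, x\<^sub>3\<^sub>1\<close>.\<close>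

definition sl2_embed :: "'k::field_char_0 sl2 \<Rightarrow> 'k tet"
  where "sl2_embed u =
    tet_scale (coeff_e u / 2) (tet_x 1 2) + tet_scale (- coeff_f u / 2) (tet_x 2 3) +
    tet_scale (coeff_h u + (coeff_e u - coeff_f u) / 2) (tet_x 3 1)"

lemma (in lie_algebra) bracket_swap: "bracket x y = - bracket y x"
proof -
  have "bracket x y + bracket y x = bracket (x + y) (x + y)"
    unfolding bracket_add_left bracket_add_right by (simp add: bracket_self)
  also have "\<dots> = 0" by (rule bracket_self)
  finally show ?thesis by (rule eq_neg_iff_add_eq_0[THEN iffD2])
qed

text \<open>Bilinearity and antisymmetry leave the three 2x2 minors of the coefficients, each
  multiplying one of the given brackets; each minor then contributes to two of x, y, z.\<close>

lemma (in lie_algebra) bracket_cyclic_combination: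
  assumes "bracket x y = scale 2 x + scale 2 y" "bracket y z = scale 2 y + scale 2 z"
    "bracket z x = scale 2 z + scale 2 x"
  shows "bracket (scale p x + scale q y + scale r z) (scale p' x + scale q' y + scale r' z) =
    scale (2 * (p * q' - q * p' + r * p' - p * r')) x +
    scale (2 * (p * q' - q * p' + q * r' - r * q')) y +
    scale (2 * (q * r' - r * q' + r * p' - p * r')) z"
proof -
  have "bracket (scale p x + scale q y + scale r z) (scale p' x + scale q' y + scale r' z) =
    scale (p * q' - q * p') (bracket x y) + scale (q * r' - r * q') (bracket y z)
    + scale (r * p' - p * r') (bracket z x)"
    using bracket_swap[of y x] bracket_swap[of z y] bracket_swap[of x z]
    by (simp add: bracket_add_left bracket_add_right bracket_scale_left bracket_scale_right
        bracket_self algebra_simps)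
  then show ?thesis unfolding assms by (simp add: algebra_simps)
qed

lemma lie_hom_sl2_embed:
  "lie_hom sl2_scale sl2_bracket tet_scale tet_bracket (sl2_embed :: 'k::field_char_0 sl2 \<Rightarrow> _)"
proof (rule lie_homI[OF lie_algebra_sl2 lie_algebra_tet])
  interpret T: lie_algebra "tet_scale :: 'k \<Rightarrow> _" tet_bracket by (rule lie_algebra_tet)
  fix u v :: "'k sl2" and c
  \<comment> \<open>The coefficients are written as sums of those of u and v, so that
    \<open>scale_left_distrib\<close> splits each term.\<close>
  have "sl2_embed (u + v) =
    tet_scale (coeff_e u / 2 + coeff_e v / 2) (tet_x 1 2) +
    tet_scale (- coeff_f u / 2 + - coeff_f v / 2) (tet_x 2 3) +
    tet_scale (coeff_h u + (coeff_e u - coeff_f u) / 2 +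
      (coeff_h v + (coeff_e v - coeff_f v) / 2)) (tet_x 3 1)"
    unfolding sl2_embed_def
    by (intro arg_cong2[where f = "(+) :: 'k tet \<Rightarrow> _"] arg_cong2[where f = tet_scale])
      (simp_all add: plus_sl2_def field_simps)
  then show "sl2_embed (u + v) = sl2_embed u + sl2_embed v"
    unfolding T.scale_left_distrib sl2_embed_def by (simp only: ac_simps)
  show "sl2_embed (sl2_scale c u) = tet_scale c (sl2_embed u)"
    unfolding sl2_embed_def T.scale_right_distrib T.scale_scale
    by (intro arg_cong2[where f = "(+) :: 'k tet \<Rightarrow> _"] arg_cong2[where f = tet_scale])
      (simp_all add: sl2_scale_def field_simps)
  have rels:
    "tet_bracket (tet_x 1 2) (tet_x 2 3) = tet_scale (2::'k) (tet_x 1 2) + tet_scale 2 (tet_x 2 3)"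
    "tet_bracket (tet_x 2 3) (tet_x 3 1) = tet_scale (2::'k) (tet_x 2 3) + tet_scale 2 (tet_x 3 1)"
    "tet_bracket (tet_x 3 1) (tet_x 1 2) = tet_scale (2::'k) (tet_x 3 1) + tet_scale 2 (tet_x 1 2)"
    by (rule tet_rel2; simp add: tet_index_def)+
  show "sl2_embed (sl2_bracket u v) = tet_bracket (sl2_embed u) (sl2_embed v)"
    unfolding sl2_embed_def T.bracket_cyclic_combination[OF rels]
    by (intro arg_cong2[where f = "(+) :: 'k tet \<Rightarrow> _"] arg_cong2[where f = tet_scale])
      (simp_all add: sl2_bracket_def field_simps)
qed

text \<open>The elements t that act like \<open>sl2_embed (EV a t)\<close> on all of
  \<open>V\<close> form a Lie subalgebra, so generators suffice. Those among the indices 1, 2, 3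
  are, up to sign, fixed by \<open>sl2_embed\<close> after \<open>EV a\<close>. Each vanishing
  condition contains a single generator involving the index 0 and can be solved for its
  action.\<close>

lemma act_sl2_embed_EV:
  fixes scale :: "'k::field_char_0 \<Rightarrow> 'v::ab_group_add \<Rightarrow> 'v"
  assumes V: "lie_module tet_scale tet_bracket scale V act"
    and a: "a \<noteq> 0" "a \<noteq> 1"
    and van:
      "vanishes_on V act (tet_scale a (tet_x 1 0) + tet_scale (1 - a) (tet_x 1 3) - tet_x 1 2)"
      "vanishes_on V act (tet_scale a (tet_x 2 3) + tet_scale (1 - a) (tet_x 2 0) - tet_x 2 1)"
      "vanishes_on V act (tet_scale a (tet_x 3 2) + tet_scale (1 - a) (tet_x 3 1) - tet_x 3 0)"
    and v: "v \<in> V"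
  shows "act t v = act (sl2_embed (EV a t)) v"
proof -
  interpret lie_module tet_scale tet_bracket scale V act by (rule V)
  have ev: "is_EV a (EV a)" using is_EV_EV[OF a] .
  then have "lie_hom tet_scale tet_bracket sl2_scale sl2_bracket (EV a)" by (simp add: is_EV_def)
  note hom = lie_homD[OF this] lie_homD[OF lie_hom_sl2_embed]
  \<comment> \<open>The quantifier over \<open>V\<close> is needed for brackets, where the
    hypothesis for one factor is applied to the image of v under the other.\<close>
  define P where "P t \<longleftrightarrow> (\<forall>v\<in>V. act t v = act (sl2_embed (EV a t)) v)" for t
  have P_scale: "P (tet_scale c t)" if "P t" for c t
    using that by (simp add: P_def hom act_scale_left)
  have opp: "tet_x j i = tet_scale (-1) (tet_x i j :: 'k tet)"
    if "i \<in> tet_index" "j \<in> tet_index" "i \<noteq> j" for i j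
    using tet_rel1[OF that] by (simp add: eq_neg_iff_add_eq_0 add.commute)
  have act_diff: "act (x - y) v = act x v - act y v" if "v \<in> V" for x y v
    using that act_add_left[of v "x - y" y] by simp
  have act_embed: "act (sl2_embed u) v =
      scale (coeff_e u / 2) (act (tet_x 1 2) v) + scale (- coeff_f u / 2) (act (tet_x 2 3) v) +
      scale (coeff_h u + (coeff_e u - coeff_f u) / 2) (act (tet_x 3 1) v)" if "v \<in> V" for u v
    using that by (simp only: sl2_embed_def act_add_left act_scale_left)
  have I: "0 \<in> tet_index" "1 \<in> tet_index" "2 \<in> tet_index" "3 \<in> tet_index"
    by (auto simp: tet_index_def)
  have EVs: "EV a (tet_x 1 2) = EV_gen a (1, 2)" "EV a (tet_x 2 3) = EV_gen a (2, 3)"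
    "EV a (tet_x 3 1) = EV_gen a (3, 1)" "EV a (tet_x 0 1) = EV_gen a (0, 1)"
    "EV a (tet_x 0 2) = EV_gen a (0, 2)" "EV a (tet_x 0 3) = EV_gen a (0, 3)"
    by (rule is_EV_gen[OF ev]; simp add: tet_index_def)+
  have P123: "P (tet_x 1 2)" "P (tet_x 2 3)" "P (tet_x 3 1)"
    unfolding P_def EVs EV_gen_coords by (simp_all add: act_embed)
  have P0: "P (tet_x 0 1)" "P (tet_x 0 2)" "P (tet_x 0 3)"
    unfolding P_def EVs EV_gen_coords
  proof (safe)
    fix v assume v: "v \<in> V"
    let ?x = "act (tet_x 1 2) v" and ?y = "act (tet_x 2 3) v" and ?z = "act (tet_x 3 1) v"
    have neg: "act (tet_x j i) v = - act (tet_x i j) v"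
      if "i \<in> tet_index" "j \<in> tet_index" "i \<noteq> j" for i j
      using v by (simp only: opp[OF that] act_scale_left) simp
    have negs: "act (tet_x 1 0) v = - act (tet_x 0 1) v" "act (tet_x 2 0) v = - act (tet_x 0 2) v"
      "act (tet_x 3 0) v = - act (tet_x 0 3) v" "act (tet_x 2 1) v = - ?x"
      "act (tet_x 3 2) v = - ?y" "act (tet_x 1 3) v = - ?z"
      by (rule neg; simp add: tet_index_def)+
    have van':
      "scale a (- act (tet_x 0 1) v) + scale (1 - a) (- ?z) - ?x = 0"
      "scale a ?y + scale (1 - a) (- act (tet_x 0 2) v) - - ?x = 0"
      "scale a (- ?y) + scale (1 - a) ?z - - act (tet_x 0 3) v = 0"
      using van[unfolded vanishes_on_def, THEN bspec, OF v] v
      by (simp_all only: negs act_diff act_add_left act_scale_left)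
    \<comment> \<open>Each vanishing condition reads r = 0, and the two sides of the solved equation
      differ by r up to sign.\<close>
    have solve: "p = q" if "r = 0" "p = q + r \<or> p = q - r" for p q r :: 'v
      using that by auto
    have 1: "scale a (act (tet_x 0 1) v) = - ?x - scale (1 - a) ?z"
      by (rule solve[OF van'(1)]) (simp add: algebra_simps)
    have 2: "scale (1 - a) (act (tet_x 0 2) v) = ?x + scale a ?y"
      by (rule solve[OF van'(2)]) (simp add: algebra_simps)
    have 3: "act (tet_x 0 3) v = scale a ?y - scale (1 - a) ?z"
      by (rule solve[OF van'(3)]) (simp add: algebra_simps)
    have "act (tet_x 0 1) v = scale (inverse a) (- ?x - scale (1 - a) ?z)"
      unfolding 1[symmetric] using a by simp
    then show "act (tet_x 0 1) v = act (sl2_embed (Sl2 (-2 * inverse a) 0 1)) v"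
      using v a by (simp add: act_embed algebra_simps)
    have "act (tet_x 0 2) v = scale (inverse (1 - a)) (?x + scale a ?y)"
      unfolding 2[symmetric] using a by simp
    \<comment> \<open>This is the coefficient of \<open>tet_x 3 1\<close> in the image under
      \<open>sl2_embed\<close>: \<open>tet_x 0 2\<close> acts as a combination of
      \<open>tet_x 1 2\<close> and \<open>tet_x 2 3\<close> alone.\<close>
    moreover have "- (1 + a) * q + (2 * q - - 2 * a * q) / 2 = 0" for q
      by (simp add: field_simps)
    ultimately show "act (tet_x 0 2) v = act (sl2_embed (Sl2 (2 * inverse (1 - a))
        (-2 * a * inverse (1 - a)) (- (1 + a) * inverse (1 - a)))) v"
      using v by (simp only: act_embed sl2.sel) (simp add: scale_right_distrib mult.commute)
    show "act (tet_x 0 3) v = act (sl2_embed (Sl2 0 (-2 * a) (-1))) v"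
      using v a by (simp add: 3 act_embed algebra_simps)
  qed
  have "P t"
  proof (induction t rule: tet_induct)
    case (1 i j)
    have P': "P (tet_x j i)" if "P (tet_x i j)" "i \<in> tet_index" "j \<in> tet_index" "i \<noteq> j" for i j
      unfolding opp[OF that(2-4)] by (rule P_scale[OF that(1)])
    have "(i = 0 \<or> i = 1 \<or> i = 2 \<or> i = 3) \<and> (j = 0 \<or> j = 1 \<or> j = 2 \<or> j = 3)"
      using 1 by (auto simp: tet_index_def)
    then show ?case
      using 1(3) P123 P0 P'[OF P123(1)] P'[OF P123(2)] P'[OF P123(3)] P'[OF P0(1)]
        P'[OF P0(2)] P'[OF P0(3)] I by (elim conjE disjE) simp_all
  qed (simp_all add: P_scale, simp_all add: P_def hom act_add_left act_bracket act_closed)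
  then show ?thesis using v by (simp add: P_def)
qed

section \<open>Vanishing on evaluation modules, and the exclusion of d = 0\<close>

lemma is_EV_vanishing:
  assumes "is_EV a \<phi>" "a \<noteq> 0" "a \<noteq> 1"
  shows "\<phi> (tet_scale a (tet_x 0 1) + tet_scale (1 - a) (tet_x 0 2) - tet_x 0 3) = 0"
    "\<phi> (tet_scale a (tet_x 1 0) + tet_scale (1 - a) (tet_x 1 3) - tet_x 1 2) = 0"
    "\<phi> (tet_scale a (tet_x 2 3) + tet_scale (1 - a) (tet_x 2 0) - tet_x 2 1) = 0"
    "\<phi> (tet_scale a (tet_x 3 2) + tet_scale (1 - a) (tet_x 3 1) - tet_x 3 0) = 0"
proof -
  have hom: "lie_hom tet_scale tet_bracket sl2_scale sl2_bracket \<phi>"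
    using assms(1) by (simp add: is_EV_def)
  have diff: "\<phi> (s - t) = \<phi> s - \<phi> t" for s t
    using lie_homD(1)[OF hom, of "s - t" t] by simp
  have gen: "\<phi> (tet_x i j) = EV_gen a (i, j)"
    if "i \<in> {0, 1, 2, 3}" "j \<in> {0, 1, 2, 3}" "i \<noteq> j" for i j
    using is_EV_gen[OF assms(1)] that by (simp add: tet_index_def)
  \<comment> \<open>Naming the inverses turns each coordinate identity into a polynomial consequence
    of a p = 1 and (1 - a) q = 1.\<close>
  define p q where "p = inverse a" and "q = inverse (1 - a)"
  have pq: "a * p = 1" "(1 - a) * q = 1" using assms by (simp_all add: p_def q_def)
  note s = diff lie_homD[OF hom] gen EV_gen_coords[of a, folded p_def q_def] sl2_simps sl2.sel
    sl2.inject
  show "\<phi> (tet_scale a (tet_x 0 1) + tet_scale (1 - a) (tet_x 0 2) - tet_x 0 3) = 0"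
    "\<phi> (tet_scale a (tet_x 1 0) + tet_scale (1 - a) (tet_x 1 3) - tet_x 1 2) = 0"
    "\<phi> (tet_scale a (tet_x 2 3) + tet_scale (1 - a) (tet_x 2 0) - tet_x 2 1) = 0"
    "\<phi> (tet_scale a (tet_x 3 2) + tet_scale (1 - a) (tet_x 3 1) - tet_x 3 0) = 0"
    by (simp add: s del: EV_gen.simps One_nat_def; (intro conjI)?; use pq in algebra)+
qed

lemma vanishes_on_isomorphic:
  assumes "lie_module ls b s V act" "module_isomorphic s V act s' W act'"
    and "\<And>w. w \<in> W \<Longrightarrow> act' x w = 0"
  shows "vanishes_on V act x"
proof -
  interpret lie_module ls b s V act by (rule assms)
  obtain \<phi> where \<phi>: "bij_betw \<phi> V W" "\<And>v w. v \<in> V \<Longrightarrow> w \<in> V \<Longrightarrow> \<phi> (v + w) = \<phi> v + \<phi> w"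
    "\<And>x v. v \<in> V \<Longrightarrow> \<phi> (act x v) = act' x (\<phi> v)"
    using assms(2) by (auto simp: module_isomorphic_def)
  have 0: "0 \<in> V" by (rule subspace_0[OF subspace_V])
  then have "\<phi> 0 = 0" using \<phi>(2)[of 0 0] by simp
  then have "act x v = 0" if "v \<in> V" for v
    using \<phi>(1) \<phi>(3)[OF that, of x] assms(3) act_closed[OF that] 0 that
    by (metis bij_betw_imp_inj_on bij_betwE inj_onD)
  then show ?thesis by (simp add: vanishes_on_def)
qed

text \<open>\<open>sl2_V 0\<close> consists of the constants, so the preimage of 1 spans
  \<open>V\<close>. This supplies the dimension clause of \<open>trivial_module\<close> when d = 0
  is ruled out.\<close>

lemma dim_isomorphic_sl2_V_0:
  fixes s :: "'k::field \<Rightarrow> 'v::ab_group_add \<Rightarrow> 'v"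
  assumes "lie_module ls b s V act" "module_isomorphic s V act smult (sl2_V 0) act'"
  shows "vector_space.dim s V = 1"
proof -
  interpret lie_module ls b s V act by (rule assms)
  obtain \<phi> where \<phi>: "bij_betw \<phi> V (sl2_V 0)" "\<And>c v. v \<in> V \<Longrightarrow> \<phi> (s c v) = smult c (\<phi> v)"
    using assms(2) by (auto simp: module_isomorphic_def)
  have "1 \<in> (sl2_V 0 :: 'k poly set)" by (simp add: sl2_V_def)
  then obtain v where v: "v \<in> V" "\<phi> v = 1" using \<phi>(1) by (metis bij_betw_imp_surj_on imageE)
  have "v \<noteq> 0" using \<phi>(2)[of 0 0] v subspace_0[OF subspace_V] by auto
  have "w \<in> span {v}" if w: "w \<in> V" for w
  proof -
    have "degree (\<phi> w) = 0" using \<phi>(1) w by (auto simp: bij_betw_def sl2_V_def)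
    then obtain c where "\<phi> w = [:c:]" by (metis degree_eq_zeroE)
    then have "\<phi> w = \<phi> (s c v)" using \<phi>(2)[OF v(1)] v(2) by simp
    then have "w = s c v"
      using \<phi>(1) w subspace_scale[OF subspace_V v(1)] by (metis bij_betw_imp_inj_on inj_onD)
    then show ?thesis by (simp add: span_base span_scale)
  qed
  then show ?thesis
    using dim_unique[of "{v}" V 1] v \<open>v \<noteq> 0\<close> by auto
qed

theorem proposition6p1:
  fixes scale :: "'k::{alg_closed_field, field_char_0} \<Rightarrow> 'v::ab_group_add \<Rightarrow> 'v"
    and V :: "'v set" and act :: "'k tet \<Rightarrow> 'v \<Rightarrow> 'v" and a :: 'k
  assumes "lie_module tet_scale tet_bracket scale V act"
    and "fin_dim scale V"
    and "irreducible_module scale V act"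
    and "\<not> trivial_module scale V act"
    and "a \<noteq> 0" and "a \<noteq> 1"
  shows "(\<exists>d\<ge>1. module_isomorphic scale V act smult (sl2_V d) (evaluation_act d a)) \<longleftrightarrow>
    vanishes_on V act (tet_scale a (tet_x 0 1) + tet_scale (1 - a) (tet_x 0 2) - tet_x 0 3) \<and>
    vanishes_on V act (tet_scale a (tet_x 1 0) + tet_scale (1 - a) (tet_x 1 3) - tet_x 1 2) \<and>
    vanishes_on V act (tet_scale a (tet_x 2 3) + tet_scale (1 - a) (tet_x 2 0) - tet_x 2 1) \<and>
    vanishes_on V act (tet_scale a (tet_x 3 2) + tet_scale (1 - a) (tet_x 3 1) - tet_x 3 0)"
    (is "?iso \<longleftrightarrow> ?van")
proof
  have "vanishes_on V act t"
    if "EV a t = 0" "module_isomorphic scale V act smult (sl2_V d) (evaluation_act d a)" for d t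
    using vanishes_on_isomorphic[OF assms(1) that(2)] that(1)
    by (simp add: evaluation_act_def sl2_act_def zero_sl2_def)
  then show ?van if ?iso
    using that is_EV_vanishing[OF is_EV_EV[OF assms(5,6)] assms(5,6)] by blast
next
  assume ?van
  then have eq: "act t v = act (sl2_embed (EV a t)) v" if "v \<in> V" for t v
    using act_sl2_embed_EV[OF assms(1,5,6) _ _ _ that] by blast
  interpret S: sl2_module scale V "\<lambda>u. act (sl2_embed u)"
    using lie_module_pullback[OF lie_algebra_sl2 lie_hom_sl2_embed assms(1)]
    by (rule sl2_module.intro)
  \<comment> \<open>Every t acts as an element of the image of \<open>sl2_embed\<close>, so
    irreducibility passes to the restricted action of sl2.\<close>
  have "submodule scale V act U" if "submodule scale V (\<lambda>u. act (sl2_embed u)) U" for U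
    using that eq unfolding submodule_def by (metis subsetD)
  then have "irreducible_module scale V (\<lambda>u. act (sl2_embed u))"
    using assms(3) unfolding irreducible_module_def by blast
  moreover have "\<exists>z. poly p z = 0" if "degree p > 0" for p :: "'k poly"
    using that by (rule alg_closed_imp_poly_has_root)
  ultimately obtain d where
    "module_isomorphic scale V (\<lambda>u. act (sl2_embed u)) smult (sl2_V d) (sl2_act d)"
    using S.isomorphic_sl2_V assms(2) by blast
  \<comment> \<open>The same map works: its compatibility with u in sl2 is used at u =
    \<open>EV a t\<close>.\<close>
  then have iso: "module_isomorphic scale V act smult (sl2_V d) (evaluation_act d a)"
    unfolding module_isomorphic_def evaluation_act_def by (metis eq)
  have "d \<noteq> 0"
  proof
    assume d: "d = 0"
    have "vanishes_on V act t" for t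
    proof -
      \<comment> \<open>On constants \<open>e\<close> acts as differentiation, hence as 0, and
        \<open>f\<close> and \<open>h\<close> act with the factor d = 0.\<close>
      have "evaluation_act 0 a t p = 0" if "p \<in> sl2_V 0" for p
        using that by (simp add: poly_eq_iff evaluation_act_def coeff_sl2_act sl2_V_eq)
          (metis Suc_lessI zero_less_diff)
      then show ?thesis
        using vanishes_on_isomorphic[OF assms(1) iso[unfolded d]] by blast
    qed
    then show False
      using assms(4) dim_isomorphic_sl2_V_0[OF assms(1) iso[unfolded d]]
      by (simp add: trivial_module_def)
  qed
  then show ?iso using iso by (intro exI[of _ d]) simp
qed

end
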